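(* There exist constants $\alpha>0$, $\beta>0$, $c>0$ and $L>0$ such that the following holds for all sufficiently large $n$. Let $\epsilon,\rho\in(0,1]$ satisfy $\rho\ge \frac{L\log^{4/5} n}{n^{1/5}\epsilon^{4/5}}$, and let $G$ be either the path or the cycle on the vertex set $\mathbb{Z}_n$. Then the algorithm $\mathcal{T}$ described in the context (instantiated with the constants $\alpha,\beta,c,L$) is an $(\epsilon,\rho)$-uniformity tester for $G$ with error probability at most $1/3$; its sample complexity is $\Theta\!\left(\frac{\sqrt n}{\epsilon^2\rho^{3/2}}\log^2 n\right)$ and it makes zero label queries.
   Context: Throughout, $\log$ is the natural logarithm. Let $G$ be the path on $\mathbb{Z}_n=\{0,\dots,n-1\}$ (edges $\{i,i+1\}$ for $0\le i\le n-2$) or the cycle (additionally the edge $\{n-1,0\}$). For a resolution parameter $\rho\in(0,1]$, a random clustering is generated as follows: each edge of $G$ is deleted independently with probability $\rho$, giving a random subgraph $\boldsymbol H$; the cells of the clustering are the connected components of $\boldsymbol H$, and each cell is assigned a representative chosen uniformly at random from the cell. A tester has access to (i) a clustered-sample oracle, which on each request returns, independently, the representative of the cell containing a point $x\sim\mu$, where $\mu$ is an unknown distribution on $\mathbb{Z}_n$; and (ii) a label oracle, which on query $x$ returns the representative of the cell containing $x$. Let $\nu$ be the uniform distribution on $\mathbb{Z}_n$. An algorithm is an $(\epsilon,\rho)$-uniformity tester for $G$ with error probability $\delta$ if for every distribution $\mu$ on $\mathbb{Z}_n$: if $\mu=\nu$ it accepts with probability at least $1-\delta$, and if $\mathrm{d}_{TV}(\mu,\nu)>\epsilon$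 it rejects with probability at least $1-\delta$, where probabilities are over the algorithm's randomness, the oracle responses, and the random clustering. Let $\phi_{i,j}$ denote the probability (over the random clustering) that vertices $i,j$ lie in the same cell. Algorithm $\mathcal{T}$ (on input $n,\epsilon,\rho$): set $m=c\cdot\frac{\sqrt n}{\epsilon^2}\cdot\frac{\log^2 n}{\rho^{3/2}}$; draw a number $N\sim\mathrm{Poi}(m)$ and request $N$ clustered samples; for each cell $\Gamma_i$ let $X_i$ be the number of returned samples equal to the representative of $\Gamma_i$; if $\max_i X_i\ge \alpha\log n$, reject; let $Y=\frac{1}{m^2}\sum_i X_i(X_i-1)$; if $Y\ge \frac{1}{n^2}\sum_{i,j}\phi_{i,j}+\beta\frac{1}{n}\epsilon^2\rho$, reject; otherwise accept. *)

theory Defs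
  imports "HOL-Probability.Probability"
begin

section \<open>Path and cycle on \<open>{0..<n}\<close>\<close>

text \<open>An edge is the set of its two end points; a graph on \<open>{..<n}\<close> is given by its edge set.\<close>

definition path_edges :: "nat \<Rightarrow> nat set set" where
  "path_edges n = {{i, i + 1} | i. i + 1 < n}"

definition cycle_edges :: "nat \<Rightarrow> nat set set" where
  "cycle_edges n = insert {n - 1, 0} (path_edges n)"

section \<open>Random clusterings\<close>

definition random_subgraph :: "nat set set \<Rightarrow> real \<Rightarrow> nat set set pmf" where
  "random_subgraph E \<rho> =
     map_pmf (\<lambda>deleted. {e \<in> E. \<not> deleted e}) (Pi_pmf E False (\<lambda>_. bernoulli_pmf \<rho>))"

definition cell_of :: "nat set set \<Rightarrow> nat \<Rightarrow> nat set" where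
  "cell_of H x = {y. (x, y) \<in> {(u, v). {u, v} \<in> H}\<^sup>*}"

definition cells :: "nat \<Rightarrow> nat set set \<Rightarrow> nat set set" where
  "cells n H = cell_of H ` {..<n}"

definition same_cell_prob :: "nat set set \<Rightarrow> real \<Rightarrow> nat \<Rightarrow> nat \<Rightarrow> real" where
  "same_cell_prob E \<rho> i j =
     measure_pmf.prob (random_subgraph E \<rho>) {H. cell_of H i = cell_of H j}"

text \<open>
  A clustering is seen by a tester only through the map sending a vertex to the representative
  of its cell.  Given the cells, the representatives are independent and uniform.
  (Arguments outside \<open>{..<n}\<close> are mapped to the dummy value \<open>0\<close>.)
\<close>

definition random_clustering :: "nat \<Rightarrow> nat set set \<Rightarrow> real \<Rightarrow> (nat \<Rightarrow> nat) pmf" where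
  "random_clustering n E \<rho> =
     bind_pmf (random_subgraph E \<rho>) (\<lambda>H.
       map_pmf (\<lambda>r x. r (cell_of H x)) (Pi_pmf (cells n H) 0 pmf_of_set))"

section \<open>Algorithms with oracle access\<close>

text \<open>
  \<open>Output b\<close> halts, accepting iff \<open>b\<close>; \<open>Random p\<close> continues with an algorithm drawn from \<open>p\<close>
  (internal randomness); \<open>Request_Sample k\<close> and \<open>Query_Label x k\<close> call an oracle and pass its
  response to \<open>k\<close>.
\<close>

datatype algorithm =
    Output bool
  | Random "algorithm pmf"
  | Request_Sample "nat \<Rightarrow> algorithm"
  | Query_Label nat "nat \<Rightarrow> algorithm"

record outcome =
  accepted :: bool
  num_samples :: nat
  num_labels :: nat

text \<open>
  In \<open>run \<mu> r A\<close>, the distribution \<open>\<mu>\<close> and the clustering \<open>r\<close> are fixed: every sample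
  request draws a fresh \<open>x\<close> from \<open>\<mu>\<close> and returns \<open>r x\<close>.
\<close>

primrec run :: "nat pmf \<Rightarrow> (nat \<Rightarrow> nat) \<Rightarrow> algorithm \<Rightarrow> outcome pmf" where
  "run \<mu> r (Output b) = return_pmf \<lparr>accepted = b, num_samples = 0, num_labels = 0\<rparr>"
| "run \<mu> r (Random p) = join_pmf (map_pmf (run \<mu> r) p)"
| "run \<mu> r (Request_Sample k) =
     bind_pmf \<mu> (\<lambda>x. map_pmf (num_samples_update Suc) (run \<mu> r (k (r x))))"
| "run \<mu> r (Query_Label x k) = map_pmf (num_labels_update Suc) (run \<mu> r (k (r x)))"

definition execution :: "nat \<Rightarrow> nat set set \<Rightarrow> real \<Rightarrow> nat pmf \<Rightarrow> algorithm \<Rightarrow> outcome pmf" where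
  "execution n E \<rho> \<mu> A = bind_pmf (random_clustering n E \<rho>) (\<lambda>r. run \<mu> r A)"

section \<open>Uniformity testers and their complexity\<close>

definition distributions :: "nat \<Rightarrow> nat pmf set" where
  "distributions n = {\<mu>. set_pmf \<mu> \<subseteq> {..<n}}"

definition tv_dist :: "nat \<Rightarrow> nat pmf \<Rightarrow> nat pmf \<Rightarrow> real" where
  "tv_dist n p q = (\<Sum>i<n. \<bar>pmf p i - pmf q i\<bar>) / 2"

definition uniformity_tester ::
    "nat \<Rightarrow> nat set set \<Rightarrow> real \<Rightarrow> real \<Rightarrow> real \<Rightarrow> algorithm \<Rightarrow> bool" where
  "uniformity_tester n E \<epsilon> \<rho> \<delta> A \<longleftrightarrow>
     (\<forall>\<mu>\<in>distributions n.
        (\<mu> = pmf_of_set {..<n} \<longrightarrow>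
           measure_pmf.prob (execution n E \<rho> \<mu> A) {\<omega>. accepted \<omega>} \<ge> 1 - \<delta>) \<and>
        (tv_dist n \<mu> (pmf_of_set {..<n}) > \<epsilon> \<longrightarrow>
           measure_pmf.prob (execution n E \<rho> \<mu> A) {\<omega>. \<not> accepted \<omega>} \<ge> 1 - \<delta>))"

text \<open>
  The number of samples may be random (and unbounded, e.g. Poisson), so the complexity is its
  expectation, in the worst case over the input distribution.
\<close>

definition sample_complexity :: "nat \<Rightarrow> nat set set \<Rightarrow> real \<Rightarrow> algorithm \<Rightarrow> ennreal" where
  "sample_complexity n E \<rho> A =
     (SUP \<mu>\<in>distributions n. \<integral>\<^sup>+ \<omega>. of_nat (num_samples \<omega>) \<partial>measure_pmf (execution n E \<rho> \<mu> A))"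

definition no_label_queries :: "nat \<Rightarrow> nat set set \<Rightarrow> real \<Rightarrow> algorithm \<Rightarrow> bool" where
  "no_label_queries n E \<rho> A \<longleftrightarrow>
     (\<forall>\<mu>\<in>distributions n. \<forall>\<omega>\<in>set_pmf (execution n E \<rho> \<mu> A). num_labels \<omega> = 0)"

section \<open>The algorithm\<close>

primrec request_samples :: "nat \<Rightarrow> (nat list \<Rightarrow> algorithm) \<Rightarrow> algorithm" where
  "request_samples 0 k = k []"
| "request_samples (Suc N) k = Request_Sample (\<lambda>v. request_samples N (\<lambda>vs. k (v # vs)))"

definition tester_rate :: "real \<Rightarrow> nat \<Rightarrow> real \<Rightarrow> real \<Rightarrow> real" where
  "tester_rate c n \<epsilon> \<rho> = c * (sqrt n / \<epsilon>\<^sup>2) * ((ln n)\<^sup>2 / \<rho> powr (3/2))"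

text \<open>
  The algorithm does not see the cells, only representatives.  A vertex \<open>v\<close> occurs in the list
  \<open>vs\<close> of responses only if it represents a cell, and then \<open>count_list vs v\<close> is the count \<open>X\<^sub>i\<close>
  of that cell; all other vertices have count \<open>0\<close>.  So the maximum and the sum over cells
  are the maximum and the sum over all vertices.
\<close>

definition decision ::
    "real \<Rightarrow> real \<Rightarrow> real \<Rightarrow> nat \<Rightarrow> nat set set \<Rightarrow> real \<Rightarrow> real \<Rightarrow> nat list \<Rightarrow> bool" where
  "decision \<alpha> \<beta> c n E \<epsilon> \<rho> vs =
     (let m = tester_rate c n \<epsilon> \<rho>;
          X = (\<lambda>v. real (count_list vs v));
          Y = 1 / m\<^sup>2 * (\<Sum>v<n. X v * (X v - 1))
      in if (MAX v\<in>{..<n}. X v) \<ge> \<alpha> * ln n then False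
         else if Y \<ge> 1 / (real n)\<^sup>2 * (\<Sum>i<n. \<Sum>j<n. same_cell_prob E \<rho> i j)
                       + \<beta> * (1 / n) * \<epsilon>\<^sup>2 * \<rho> then False
         else True)"

definition tester ::
    "real \<Rightarrow> real \<Rightarrow> real \<Rightarrow> nat \<Rightarrow> nat set set \<Rightarrow> real \<Rightarrow> real \<Rightarrow> algorithm" where
  "tester \<alpha> \<beta> c n E \<epsilon> \<rho> =
     Random (map_pmf (\<lambda>N. request_samples N (\<lambda>vs. Output (decision \<alpha> \<beta> c n E \<epsilon> \<rho> vs)))
                     (poisson_pmf (tester_rate c n \<epsilon> \<rho>)))"

end

theory Submission
  imports Defs
begin

text \<open>
  Write \<open>S\<close> for the sum of the squared masses of the cells.  Given the clustering, the counts of a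
  Poisson number of samples make \<open>Y\<close> an unbiased estimator of \<open>S\<close> with variance at most
  \<open>(4 A / m + 2 / m\<^sup>2) S\<close> if no cell has mass above \<open>A\<close>.  Closing a path to a cycle merges at most two
  cells, so it suffices to understand \<open>S\<close> on the path.  There \<open>S\<close> is built up by an explicit
  Markov chain along the path: its mean diagonalises as
  \<open>(1 - q\<^sup>2) (s\<^sub>0\<^sup>2 + \<dots> + s\<^sub>N\<^sub>-\<^sub>1\<^sup>2) + s\<^sub>N\<^sup>2\<close> with \<open>s\<^sub>i = z\<^sub>i + q s\<^sub>i\<^sub>-\<^sub>1\<close> and \<open>q = 1 - \<rho>\<close>, which
  gives a gap of order \<open>\<epsilon>\<^sup>2 \<rho> / n\<close> between a far distribution and the uniform one, and its martingale
  increments bound the variance of \<open>S\<close> by \<open>O(M\<^sup>2) E S\<close> as soon as every interval of about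
  \<open>1 / (10 \<rho>)\<close> vertices has mass at most \<open>M\<close>.  If some such interval is heavier than
  \<open>M = O(log n / m)\<close>, it stays in one cell with probability \<open>9/10\<close>, and the maximum test rejects.
\<close>

section \<open>Poissonized samples\<close>

text \<open>The obstacle is to lose no logarithm in the variance of \<open>S\<close>. Blocks can
  have length of order \<open>log n / \<rho>\<close>, so light windows only limit the mass of a
  block to \<open>O(l M)\<close> with \<open>l = log n\<close>. A bounded-difference argument with
  that mass would cost a factor \<open>l\<^sup>2\<close>, all that the rate has to spare. The
  martingale increments contain instead the mass to the right discounted by survival probabilities,
  a geometric series of value \<open>O(M)\<close>. The mass of whole cells enters only the sampling
  variance, where \<open>l M / m\<close> is again of order \<open>M\<^sup>2\<close>. The lower bound
  on \<open>\<rho>\<close>, raised to the fifth power, says \<open>m \<le> \<rho> n\<close> when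
  \<open>c = L = 1\<close>. It keeps the counts under the uniform distribution of order
  \<open>log n\<close>, and it pushes the terms caused by end points and by closing the cycle, of
  order \<open>(log n / (n \<rho>))\<^sup>2\<close>, below the energy gap.\<close>

lemma finite_set_replicate_pmf:
  assumes "finite (set_pmf p)"
  shows "finite (set_pmf (replicate_pmf N p))"
  using assms finite_lists_length_eq[of "set_pmf p" N]
  by (simp add: set_replicate_pmf lists_eq_set)

lemma integrable_replicate_pmf [simp]:
  fixes f :: "'a list \<Rightarrow> real"
  assumes "finite (set_pmf p)"
  shows "integrable (measure_pmf (replicate_pmf N p)) f"
  using assms by (intro integrable_measure_pmf_finite finite_set_replicate_pmf)

lemma expectation_replicate_pmf_Suc:
  fixes f :: "'a list \<Rightarrow> real"
  assumes "finite (set_pmf p)"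
  shows "measure_pmf.expectation (replicate_pmf (Suc N) p) f =
    (\<Sum>x\<in>set_pmf p. pmf p x * measure_pmf.expectation (replicate_pmf N p) (\<lambda>xs. f (x # xs)))"
proof -
  have "replicate_pmf (Suc N) p = bind_pmf p (\<lambda>x. map_pmf ((#) x) (replicate_pmf N p))"
    by (simp add: map_pmf_def)
  then show ?thesis
    using assms by (simp add: pmf_expectation_bind[of "set_pmf p"] finite_set_replicate_pmf del: replicate_pmf.simps)
qed

lemma sum_pmf_point:
  assumes "finite (set_pmf p)"
  shows "(\<Sum>x\<in>set_pmf p. pmf p x * (if x = v then c else (0::real))) = pmf p v * c"
  using assms by (auto simp: if_distrib[of "\<lambda>y. _ * y"] sum.delta set_pmf_iff cong: if_cong)

text \<open>The product counts pairs of disjoint position sets, \<open>a\<close> positions holding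
  \<open>v\<close> and \<open>b\<close> holding \<open>w\<close>. There are
  \<open>(N choose (a + b)) * (a + b choose a)\<close> candidates, each realised with probability
  \<open>pmf p v ^ a * pmf p w ^ b\<close>. The induction peels off the first sample by Pascal's
  rule.\<close>

lemma expectation_binomial_counts:
  fixes p :: "'a pmf"
  assumes fin: "finite (set_pmf p)" and "v \<noteq> w"
  shows "measure_pmf.expectation (replicate_pmf N p)
      (\<lambda>xs. real (count_list xs v choose a) * real (count_list xs w choose b)) =
    real (N choose (a + b)) * real (a + b choose a) * pmf p v ^ a * pmf p w ^ b"
proof (induction N arbitrary: a b)
  case 0
  then show ?case by (cases a; cases b) auto
next
  case (Suc N)
  define G where "G a b = measure_pmf.expectation (replicate_pmf N p)
      (\<lambda>xs. real (count_list xs v choose a) * real (count_list xs w choose b))" for a b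
  \<comment> \<open>The extra Pascal term when the first sample is \<open>v\<close>; it is
    \<open>0\<close> for \<open>a = 0\<close>, since \<open>Suc c choose 0\<close> does not grow.
    \<open>Gb\<close> does the same for \<open>w\<close>.\<close>
  define Ga where "Ga = (case a of 0 \<Rightarrow> 0 | Suc a' \<Rightarrow> G a' b)"
  define Gb where "Gb = (case b of 0 \<Rightarrow> 0 | Suc b' \<Rightarrow> G a b')"
  have step: "measure_pmf.expectation (replicate_pmf N p)
      (\<lambda>xs. real (count_list (x # xs) v choose a) * real (count_list (x # xs) w choose b))
      = G a b + (if x = v then Ga else 0) + (if x = w then Gb else 0)" for x
    using \<open>v \<noteq> w\<close> fin
    by (auto simp: G_def Ga_def Gb_def ring_distribs split: nat.splits)
  have "measure_pmf.expectation (replicate_pmf (Suc N) p)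
      (\<lambda>xs. real (count_list xs v choose a) * real (count_list xs w choose b))
    = (\<Sum>x\<in>set_pmf p. pmf p x * (G a b + (if x = v then Ga else 0) + (if x = w then Gb else 0)))"
    by (simp only: expectation_replicate_pmf_Suc[OF fin] step)
  also have "\<dots> = G a b + pmf p v * Ga + pmf p w * Gb"
    using fin by (simp add: ring_distribs sum.distrib sum_pmf_point sum_distrib_right[symmetric] sum_pmf_eq_1)
  also have "\<dots> = real (Suc N choose (a + b)) * real (a + b choose a) * pmf p v ^ a * pmf p w ^ b"
    using Suc.IH unfolding Ga_def Gb_def G_def[symmetric]
    by (cases a; cases b) (simp_all add: algebra_simps)
  finally show ?case .
qed

lemma expectation_power_count:
  fixes p :: "'a pmf" and t :: real
  assumes fin: "finite (set_pmf p)"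
  shows "measure_pmf.expectation (replicate_pmf N p) (\<lambda>xs. t ^ count_list xs v) =
    (1 + (t - 1) * pmf p v) ^ N"
proof (induction N)
  case (Suc N)
  have "measure_pmf.expectation (replicate_pmf (Suc N) p) (\<lambda>xs. t ^ count_list xs v)
    = (\<Sum>x\<in>set_pmf p. pmf p x * ((1 + (t - 1) * pmf p v) ^ N +
        (if x = v then (t - 1) * (1 + (t - 1) * pmf p v) ^ N else 0)))"
    unfolding expectation_replicate_pmf_Suc[OF fin]
    by (intro sum.cong refl) (auto simp: Suc.IH algebra_simps)
  also have "\<dots> = (1 + (t - 1) * pmf p v) ^ Suc N"
    using fin by (simp add: ring_distribs sum.distrib sum_pmf_point sum_distrib_right[symmetric] sum_pmf_eq_1 algebra_simps)
  finally show ?case .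
qed auto

section \<open>Mixing over a Poisson number of samples\<close>

lemma expectation_nat_pmf_sums:
  fixes f :: "nat \<Rightarrow> real"
  assumes "\<And>k. f k \<ge> 0" "(\<lambda>k. pmf p k * f k) sums s"
  shows "integrable (measure_pmf p) f" "measure_pmf.expectation p f = s"
proof -
  have "summable (\<lambda>k. pmf p k * f k)" using assms(2) by (rule sums_summable)
  then have i: "integrable (count_space UNIV) (\<lambda>k. pmf p k * f k)"
    using assms(1) by (simp add: integrable_count_space_nat_iff)
  then show "integrable (measure_pmf p) f"
    unfolding measure_pmf_eq_density by (subst integrable_density) auto
  have "measure_pmf.expectation p f = (\<integral>k. pmf p k * f k \<partial>count_space UNIV)"
    unfolding measure_pmf_eq_density by (subst integral_density) auto
  also have "\<dots> = s"
    using sums_integral_count_space_nat[OF i] assms(2) sums_unique2 by blast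
  finally show "measure_pmf.expectation p f = s" .
qed

text \<open>The terms below \<open>N = k\<close> vanish, and after a shift by \<open>k\<close> the
  series is the exponential series times \<open>m ^ k / fact k * exp (- m)\<close>.\<close>

lemma poisson_binomial_moment:
  assumes "m > 0"
  shows "integrable (measure_pmf (poisson_pmf m)) (\<lambda>N. real (N choose k))"
    "measure_pmf.expectation (poisson_pmf m) (\<lambda>N. real (N choose k)) = m ^ k / fact k"
proof -
  have eq: "m ^ (i + k) / fact (i + k) * exp (- m) * real (i + k choose k) =
      m ^ k / fact k * exp (- m) * (m ^ i /\<^sub>R fact i)" for i
    using binomial_fact[of k "i + k", where 'a = real] by (simp add: power_add field_simps)
  have "(\<lambda>i. m ^ k / fact k * exp (- m) * (m ^ i /\<^sub>R fact i)) sums (m ^ k / fact k * exp (- m) * exp m)"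
    by (intro sums_mult exp_converges)
  then have "(\<lambda>i. m ^ (i + k) / fact (i + k) * exp (- m) * real (i + k choose k)) sums (m ^ k / fact k)"
    unfolding eq by (simp add: exp_minus divide_inverse mult.assoc)
  then have "(\<lambda>N. m ^ N / fact N * exp (- m) * real (N choose k)) sums
      (m ^ k / fact k + (\<Sum>i<k. m ^ i / fact i * exp (- m) * real (i choose k)))"
    by (rule sums_iff_shift[where n = k and f = "\<lambda>N. m ^ N / fact N * exp (- m) * real (N choose k)", THEN iffD1])
  moreover have "(\<Sum>i<k. m ^ i / fact i * exp (- m) * real (i choose k)) = 0"
    by (intro sum.neutral) auto
  ultimately have "(\<lambda>N. pmf (poisson_pmf m) N * real (N choose k)) sums (m ^ k / fact k)"
    using assms by simp
  then show "integrable (measure_pmf (poisson_pmf m)) (\<lambda>N. real (N choose k))"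
    "measure_pmf.expectation (poisson_pmf m) (\<lambda>N. real (N choose k)) = m ^ k / fact k"
    by (auto intro!: expectation_nat_pmf_sums)
qed

lemma poisson_pgf:
  assumes "m > 0" "t \<ge> 0"
  shows "integrable (measure_pmf (poisson_pmf m)) (\<lambda>N. t ^ N)"
    "measure_pmf.expectation (poisson_pmf m) (\<lambda>N. t ^ N) = exp ((t - 1) * m)"
proof -
  have "(\<lambda>N. exp (- m) * ((t * m) ^ N /\<^sub>R fact N)) sums (exp (- m) * exp (t * m))"
    by (intro sums_mult exp_converges)
  also have "(\<lambda>N. exp (- m) * ((t * m) ^ N /\<^sub>R fact N)) = (\<lambda>N. pmf (poisson_pmf m) N * t ^ N)"
    using assms by (simp add: fun_eq_iff field_simps power_mult_distrib)
  also have "exp (- m) * exp (t * m) = exp ((t - 1) * m)"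
    by (simp add: exp_add[symmetric] algebra_simps)
  finally show "integrable (measure_pmf (poisson_pmf m)) (\<lambda>N. t ^ N)"
    "measure_pmf.expectation (poisson_pmf m) (\<lambda>N. t ^ N) = exp ((t - 1) * m)"
    using assms by (auto intro!: expectation_nat_pmf_sums)
qed

definition poisson_sample :: "real \<Rightarrow> 'a pmf \<Rightarrow> 'a list pmf" where
  "poisson_sample m p = bind_pmf (poisson_pmf m) (\<lambda>N. replicate_pmf N p)"

text \<open>A Poisson mixture has infinite support, so integrability must be established. For
  nonnegative \<open>g\<close> the mixing passes through the nonnegative integral, whose finite
  value yields integrability and expectation together.\<close>

lemma expectation_bind_pmf_nonneg:
  fixes g :: "'b \<Rightarrow> real"
  assumes "\<And>x. g x \<ge> 0" "\<And>N. integrable (measure_pmf (f N)) g"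
    and h: "\<And>N. measure_pmf.expectation (f N) g = h N"
    and i: "integrable (measure_pmf M) h" and s: "measure_pmf.expectation M h = s"
  shows "integrable (measure_pmf (bind_pmf M f)) g"
    "measure_pmf.expectation (bind_pmf M f) g = s"
proof -
  have h0: "h N \<ge> 0" for N using assms(1) by (auto simp flip: h)
  then have s0: "s \<ge> 0" by (auto simp flip: s)
  have "(\<integral>\<^sup>+x. ennreal (g x) \<partial>measure_pmf (bind_pmf M f)) = (\<integral>\<^sup>+N. ennreal (h N) \<partial>measure_pmf M)"
    using assms(1,2) by (simp add: nn_integral_eq_integral h)
  also have "\<dots> = ennreal s"
    using i h0 s by (simp add: nn_integral_eq_integral)
  finally have *: "(\<integral>\<^sup>+x. ennreal (g x) \<partial>measure_pmf (bind_pmf M f)) = ennreal s" .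
  show "integrable (measure_pmf (bind_pmf M f)) g"
    "measure_pmf.expectation (bind_pmf M f) g = s"
    using nn_integral_eq_integrable[THEN iffD1, OF _ _ s0 *] assms(1) by auto
qed

text \<open>The binomial factor cancels against the moment of order \<open>a + b\<close> of the
  Poisson variable, and the joint moment factorises as for independent Poisson counts of means
  \<open>m * pmf p v\<close> and \<open>m * pmf p w\<close>. This is the form in which
  Poissonization is used for variances.\<close>

lemma poisson_sample_binomial_counts:
  fixes p :: "'a pmf" and a b :: nat
  assumes fin: "finite (set_pmf p)" and "v \<noteq> w" and m: "m > 0"
  defines "g \<equiv> (\<lambda>xs. real (count_list xs v choose a) * real (count_list xs w choose b))"
  shows "integrable (measure_pmf (poisson_sample m p)) g" (is ?i)
    "measure_pmf.expectation (poisson_sample m p) g =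
      (m * pmf p v) ^ a / fact a * ((m * pmf p w) ^ b / fact b)" (is ?e)
proof -
  let ?h = "\<lambda>N. real (N choose (a + b)) * real (a + b choose a) * pmf p v ^ a * pmf p w ^ b"
  have "measure_pmf.expectation (poisson_pmf m) ?h
      = m ^ (a + b) / fact (a + b) * real (a + b choose a) * pmf p v ^ a * pmf p w ^ b"
    using poisson_binomial_moment[OF m, of "a + b"] by simp
  also have "\<dots> = (m * pmf p v) ^ a / fact a * ((m * pmf p w) ^ b / fact b)"
    using binomial_fact[of a "a + b", where 'a = real] by (simp add: power_add power_mult_distrib)
  finally have e: "measure_pmf.expectation (poisson_pmf m) ?h =
      (m * pmf p v) ^ a / fact a * ((m * pmf p w) ^ b / fact b)" .
  have i: "integrable (measure_pmf (poisson_pmf m)) ?h"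
    using poisson_binomial_moment(1)[OF m] by auto
  show ?i ?e
    unfolding poisson_sample_def
    by (rule expectation_bind_pmf_nonneg[OF _ _ _ i e];
        use fin \<open>v \<noteq> w\<close> in \<open>simp add: g_def expectation_binomial_counts\<close>)+
qed

lemma poisson_sample_binomial_count:
  fixes p :: "nat pmf"
  assumes "finite (set_pmf p)" "m > 0"
  shows "integrable (measure_pmf (poisson_sample m p)) (\<lambda>xs. real (count_list xs v choose a))"
    "measure_pmf.expectation (poisson_sample m p) (\<lambda>xs. real (count_list xs v choose a)) =
      (m * pmf p v) ^ a / fact a"
  \<comment> \<open>With \<open>b = 0\<close> the second factor is \<open>1\<close>;
    \<open>Suc v\<close> merely supplies a value different from \<open>v\<close>.\<close>
  using poisson_sample_binomial_counts[of p v "Suc v" m a 0] assms by auto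

lemma poisson_sample_power_count:
  fixes p :: "'a pmf"
  assumes fin: "finite (set_pmf p)" and m: "m > 0" and t: "t \<ge> 0"
  shows "integrable (measure_pmf (poisson_sample m p)) (\<lambda>xs. t ^ count_list xs v)"
    "measure_pmf.expectation (poisson_sample m p) (\<lambda>xs. t ^ count_list xs v) = exp ((t - 1) * (m * pmf p v))"
proof -
  have "0 \<le> (1 - pmf p v) + t * pmf p v" using t by (simp add: pmf_le_1)
  then have t': "1 + (t - 1) * pmf p v \<ge> 0" by (simp add: algebra_simps)
  note P = poisson_pgf[OF m t']
  show "integrable (measure_pmf (poisson_sample m p)) (\<lambda>xs. t ^ count_list xs v)"
    "measure_pmf.expectation (poisson_sample m p) (\<lambda>xs. t ^ count_list xs v) = exp ((t - 1) * (m * pmf p v))"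
    unfolding poisson_sample_def
    by (rule expectation_bind_pmf_nonneg[OF _ _ _ P(1)];
        use fin t P(2) in \<open>simp add: expectation_power_count mult_ac\<close>)+
qed

section \<open>Tails of a single count\<close>

lemma markov_pmf:
  fixes g :: "'a \<Rightarrow> real"
  assumes "integrable (measure_pmf M) g" "\<And>x. g x \<ge> 0" "t > 0" "\<And>x. x \<in> A \<Longrightarrow> g x \<ge> t"
  shows "measure_pmf.prob M A \<le> measure_pmf.expectation M g / t"
proof -
  have "measure_pmf.prob M A \<le> measure_pmf.prob M {x \<in> space (measure_pmf M). g x \<ge> t}"
    using assms(4) by (intro measure_pmf.finite_measure_mono) auto
  also have "\<dots> \<le> measure_pmf.expectation M g / t"
    using assms by (intro integral_Markov_inequality_measure[where A = "{}"]) auto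
  finally show ?thesis .
qed

text \<open>Chernoff bound at the fixed base \<open>exp 1\<close>, using
  \<open>exp 1 - 1 \<le> 2\<close>; constant factors are all that the maximum test has to
  resolve.\<close>

lemma poisson_sample_upper_tail:
  fixes p :: "'a pmf"
  assumes "finite (set_pmf p)" "m > 0"
  shows "measure_pmf.prob (poisson_sample m p) {xs. real (count_list xs v) \<ge> y}
     \<le> exp (2 * (m * pmf p v) - y)"
proof -
  have "measure_pmf.prob (poisson_sample m p) {xs. real (count_list xs v) \<ge> y}
     \<le> exp ((exp 1 - 1) * (m * pmf p v)) / exp y"
    using poisson_sample_power_count[OF assms, of "exp 1" v]
      markov_pmf[OF poisson_sample_power_count(1)[OF assms, of "exp 1" v], of "exp y"
        "{xs. real (count_list xs v) \<ge> y}"]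
    by (simp add: exp_of_nat_mult[symmetric])
  also have "\<dots> = exp ((exp 1 - 1) * (m * pmf p v) - y)"
    by (simp add: exp_diff)
  also have "(exp 1 - 1) * (m * pmf p v) \<le> 2 * (m * pmf p v)"
    using exp_le assms by (intro mult_right_mono) auto
  finally show ?thesis by simp
qed

text \<open>Chernoff bound at the fixed base \<open>exp (-1)\<close>, using
  \<open>1 - exp (-1) \<ge> 1/2\<close>.\<close>

lemma poisson_sample_lower_tail:
  fixes p :: "'a pmf"
  assumes "finite (set_pmf p)" "m > 0"
  shows "measure_pmf.prob (poisson_sample m p) {xs. real (count_list xs v) \<le> y}
     \<le> exp (y - m * pmf p v / 2)"
proof -
  have "measure_pmf.prob (poisson_sample m p) {xs. real (count_list xs v) \<le> y}
     \<le> exp ((exp (-1) - 1) * (m * pmf p v)) / exp (- y)"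
    using poisson_sample_power_count[OF assms, of "exp (-1)" v]
      markov_pmf[OF poisson_sample_power_count(1)[OF assms, of "exp (-1)" v], of "exp (- y)"
        "{xs. real (count_list xs v) \<le> y}"]
    by (simp add: exp_of_nat_mult[symmetric])
  also have "\<dots> = exp ((exp (-1) - 1) * (m * pmf p v) + y)"
    by (simp add: exp_add exp_minus divide_inverse)
  also have "(exp (-1) - 1) * (m * pmf p v) \<le> (-1/2) * (m * pmf p v)"
  proof (intro mult_right_mono)
    have "exp 1 \<ge> (2::real)" using exp_ge_add_one_self[of "1::real"] by simp
    then show "exp (-1) - 1 \<le> (-1/2::real)" by (simp add: exp_minus field_simps)
  qed (use assms in auto)
  finally show ?thesis by simp
qed

section \<open>Mean and variance of the collision statistic\<close>

lemma choose_two_real: "2 * real (c choose 2) = real c * (real c - 1)"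
  by (induction c) (simp_all add: numeral_eq_Suc algebra_simps)

text \<open>Two 2-subsets have a union of 4, 3 or 2 points, and a given set is such a union for 6, 6
  or 1 ordered pairs. This turns the square into binomials, whose moments are known.\<close>

lemma choose_two_square:
  "4 * (real (c choose 2))\<^sup>2 = 24 * real (c choose 4) + 24 * real (c choose 3) + 4 * real (c choose 2)"
proof -
  have 1: "real (c choose 2) = real c * (real c - 1) / 2" for c using choose_two_real[of c] by simp
  have 2: "real (c choose 3) = real c * (real c - 1) * (real c - 2) / 6" for c
  proof (induction c)
    case (Suc c)
    have "Suc c choose 3 = (c choose 2) + (c choose 3)" by (simp add: numeral_eq_Suc)
    then show ?case using Suc 1[of c] by (simp add: field_simps)
  qed auto
  have 3: "real (c choose 4) = real c * (real c - 1) * (real c - 2) * (real c - 3) / 24" for c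
  proof (induction c)
    case (Suc c)
    have "Suc c choose 4 = (c choose 3) + (c choose 4)" by (simp add: numeral_eq_Suc)
    then show ?case using Suc 2[of c] by (simp add: field_simps)
  qed auto
  show ?thesis unfolding 1 2 3 by (simp add: field_simps power2_eq_square)
qed

text \<open>The first summand is the product of the means, so the conditional one is the
  covariance.\<close>

lemma poisson_sample_pairs_second_moment:
  fixes p :: "nat pmf" and m :: real
  assumes fin: "finite (set_pmf p)" and m: "m > 0"
  defines "g \<equiv> (\<lambda>(xs :: nat list) v. real (count_list xs v) * (real (count_list xs v) - 1))"
  shows "integrable (measure_pmf (poisson_sample m p)) (\<lambda>xs. g xs v * g xs w)" (is ?i)
    "measure_pmf.expectation (poisson_sample m p) (\<lambda>xs. g xs v * g xs w) =
      (m * pmf p v)\<^sup>2 * (m * pmf p w)\<^sup>2 + (if v = w then 4 * (m * pmf p v) ^ 3 + 2 * (m * pmf p v)\<^sup>2 else 0)" (is ?e)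
proof -
  have g: "g xs v = 2 * real (count_list xs v choose 2)" for xs v
    by (simp add: g_def choose_two_real)
  have "?i \<and> ?e"
  proof (cases "v = w")
    case True
    have *: "g xs v * g xs w = 24 * real (count_list xs v choose 4) +
        24 * real (count_list xs v choose 3) + 4 * real (count_list xs v choose 2)" for xs
      using choose_two_square[of "count_list xs v"] True by (simp add: g power2_eq_square)
    have f: "fact 4 = (24::real)" "fact 3 = (6::real)" "fact 2 = (2::real)"
      by (simp_all add: fact_numeral)
    show ?thesis unfolding *
      using True poisson_sample_binomial_count[OF fin m, of v]
      by (auto simp: f power2_eq_square eval_nat_numeral)
  next
    case False
    have "g xs v * g xs w = 4 * (real (count_list xs v choose 2) * real (count_list xs w choose 2))" for xs
      by (simp add: g)
    then show ?thesis using False poisson_sample_binomial_counts[OF fin False m, of 2 2] by auto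
  qed
  then show ?i ?e by auto
qed

lemma poisson_sample_collision_variance:
  fixes p :: "nat pmf" and m :: real and V :: "nat set"
  assumes fin: "finite (set_pmf p)" and m: "m > 0" and V: "finite V"
  defines "Y \<equiv> (\<lambda>xs. 1 / m\<^sup>2 * (\<Sum>v\<in>V. real (count_list xs v) * (real (count_list xs v) - 1)))"
    and "S \<equiv> (\<Sum>v\<in>V. (pmf p v)\<^sup>2)"
  shows "integrable (measure_pmf (poisson_sample m p)) (\<lambda>xs. (Y xs - S)\<^sup>2)" (is ?i)
    "measure_pmf.expectation (poisson_sample m p) (\<lambda>xs. (Y xs - S)\<^sup>2) =
      4 / m * (\<Sum>v\<in>V. pmf p v ^ 3) + 2 / m\<^sup>2 * S" (is ?e)
proof -
  define g where "g = (\<lambda>(xs :: nat list) v. real (count_list xs v) * (real (count_list xs v) - 1))"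
  have M2: "integrable (measure_pmf (poisson_sample m p)) (\<lambda>xs. g xs v * g xs w)"
    "measure_pmf.expectation (poisson_sample m p) (\<lambda>xs. g xs v * g xs w) =
      (m * pmf p v)\<^sup>2 * (m * pmf p w)\<^sup>2 + (if v = w then 4 * (m * pmf p v) ^ 3 + 2 * (m * pmf p v)\<^sup>2 else 0)" for v w
    unfolding g_def by (rule poisson_sample_pairs_second_moment[OF fin m])+
  have g: "g xs v = 2 * real (count_list xs v choose 2)" for xs v
    by (simp add: g_def choose_two_real)
  have M1: "integrable (measure_pmf (poisson_sample m p)) (\<lambda>xs. g xs v)"
    "measure_pmf.expectation (poisson_sample m p) (\<lambda>xs. g xs v) = (m * pmf p v)\<^sup>2" for v
    unfolding g using poisson_sample_binomial_count[OF fin m, of v 2] by (auto simp: fact_numeral)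
  let ?E = "measure_pmf.expectation (poisson_sample m p)"
  let ?l = "\<lambda>v. m * pmf p v"
  have Yg: "Y xs = (\<Sum>v\<in>V. g xs v) / m\<^sup>2" for xs by (simp add: Y_def g_def)
  have eq: "(Y xs - S)\<^sup>2 = (\<Sum>v\<in>V. \<Sum>w\<in>V. g xs v * g xs w) / m ^ 4
       - (2 * S / m\<^sup>2) * (\<Sum>v\<in>V. g xs v) + S\<^sup>2" for xs
    unfolding Yg sum_product[symmetric]
    using m by (simp add: power2_eq_square field_simps eval_nat_numeral)
  show ?i unfolding eq by (intro Bochner_Integration.integrable_add Bochner_Integration.integrable_diff
        integrable_mult_right integrable_divide Bochner_Integration.integrable_sum M1 M2) auto
  have "?E (\<lambda>xs. (Y xs - S)\<^sup>2) = (\<Sum>v\<in>V. \<Sum>w\<in>V. ?E (\<lambda>xs. g xs v * g xs w)) / m ^ 4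
       - (2 * S / m\<^sup>2) * (\<Sum>v\<in>V. ?E (\<lambda>xs. g xs v)) + S\<^sup>2"
    unfolding eq using M1(1) M2(1) by simp
  also have "(\<Sum>v\<in>V. \<Sum>w\<in>V. ?E (\<lambda>xs. g xs v * g xs w)) =
     (\<Sum>v\<in>V. \<Sum>w\<in>V. (?l v)\<^sup>2 * (?l w)\<^sup>2) + (\<Sum>v\<in>V. 4 * (?l v) ^ 3 + 2 * (?l v)\<^sup>2)"
    using V by (simp add: M2 sum.distrib)
  also have "(\<Sum>v\<in>V. \<Sum>w\<in>V. (?l v)\<^sup>2 * (?l w)\<^sup>2) = (\<Sum>v\<in>V. (?l v)\<^sup>2) * (\<Sum>v\<in>V. (?l v)\<^sup>2)"
    by (simp add: sum_product)
  also have "(\<Sum>v\<in>V. (?l v)\<^sup>2) = m\<^sup>2 * S"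
    by (simp add: S_def power_mult_distrib sum_distrib_left)
  also have "(\<Sum>v\<in>V. 4 * (?l v) ^ 3 + 2 * (?l v)\<^sup>2) = 4 * m ^ 3 * (\<Sum>v\<in>V. pmf p v ^ 3) + 2 * m\<^sup>2 * S"
    unfolding S_def by (simp add: sum.distrib power_mult_distrib sum_distrib_left mult_ac)
  also have "(\<Sum>v\<in>V. ?E (\<lambda>xs. g xs v)) = m\<^sup>2 * S"
    unfolding M1 S_def by (simp add: power_mult_distrib sum_distrib_left)
  also have "(m\<^sup>2 * S * (m\<^sup>2 * S) + (4 * m ^ 3 * (\<Sum>v\<in>V. pmf p v ^ 3) + 2 * m\<^sup>2 * S)) / m ^ 4 -
      2 * S / m\<^sup>2 * (m\<^sup>2 * S) + S\<^sup>2 = 4 / m * (\<Sum>v\<in>V. pmf p v ^ 3) + 2 / m\<^sup>2 * S"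
    using m by (simp add: field_simps eval_nat_numeral)
  finally show ?e .
qed

lemma poisson_sample_collision_chebyshev:
  fixes p :: "nat pmf" and m :: real and V :: "nat set"
  assumes fin: "finite (set_pmf p)" and m: "m > 0" and V: "finite V"
    and A: "\<And>v. v \<in> V \<Longrightarrow> pmf p v \<le> A" and t: "t > 0"
  defines "Y \<equiv> (\<lambda>xs. 1 / m\<^sup>2 * (\<Sum>v\<in>V. real (count_list xs v) * (real (count_list xs v) - 1)))"
    and "S \<equiv> (\<Sum>v\<in>V. (pmf p v)\<^sup>2)"
  shows "measure_pmf.prob (poisson_sample m p) {xs. \<bar>Y xs - S\<bar> \<ge> t} \<le> (4 * A / m + 2 / m\<^sup>2) * S / t\<^sup>2"
proof -
  note var = poisson_sample_collision_variance[OF fin m V]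
  have "measure_pmf.prob (poisson_sample m p) {xs. \<bar>Y xs - S\<bar> \<ge> t}
      \<le> measure_pmf.expectation (poisson_sample m p) (\<lambda>xs. (Y xs - S)\<^sup>2) / t\<^sup>2"
    using t unfolding Y_def S_def
    by (intro markov_pmf var) (auto intro: power2_le_iff_abs_le[THEN iffD2] simp: abs_le_square_iff[symmetric])
  also have "\<dots> \<le> (4 * A / m + 2 / m\<^sup>2) * S / t\<^sup>2"
  proof (intro divide_right_mono)
    have "(\<Sum>v\<in>V. pmf p v ^ 3) \<le> (\<Sum>v\<in>V. A * (pmf p v)\<^sup>2)"
      using A by (intro sum_mono) (auto simp: eval_nat_numeral intro!: mult_right_mono)
    then have "4 / m * (\<Sum>v\<in>V. pmf p v ^ 3) \<le> 4 / m * (A * S)"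
      using m by (intro mult_left_mono) (auto simp: S_def sum_distrib_left)
    then show "measure_pmf.expectation (poisson_sample m p) (\<lambda>xs. (Y xs - S)\<^sup>2) \<le> (4 * A / m + 2 / m\<^sup>2) * S"
      unfolding Y_def S_def var(2) by (simp add: algebra_simps)
  qed auto
  finally show ?thesis .
qed

section \<open>Random cuts of a path\<close>

definition linked :: "(nat \<Rightarrow> bool) \<Rightarrow> nat \<Rightarrow> nat \<Rightarrow> bool" where
  "linked d x y \<longleftrightarrow> (\<forall>t. min x y \<le> t \<and> t < max x y \<longrightarrow> \<not> d t)"

lemma linked_refl [simp]: "linked d x x"
  by (auto simp: linked_def)

lemma linked_sym: "linked d x y \<longleftrightarrow> linked d y x"
  by (simp add: linked_def min.commute max.commute)

lemma linked_trans: "linked d x y \<Longrightarrow> linked d y z \<Longrightarrow> linked d x z"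
  unfolding linked_def
proof (intro allI impI)
  fix t
  assume "\<forall>t. min x y \<le> t \<and> t < max x y \<longrightarrow> \<not> d t" "\<forall>t. min y z \<le> t \<and> t < max y z \<longrightarrow> \<not> d t"
    and "min x z \<le> t \<and> t < max x z"
  moreover from this(3) have "min x y \<le> t \<and> t < max x y \<or> min y z \<le> t \<and> t < max y z"
    by arith
  ultimately show "\<not> d t" by blast
qed

lemma linked_Suc: "x \<le> i \<Longrightarrow> linked d x (Suc i) \<longleftrightarrow> \<not> d i \<and> linked d x i"
  by (auto simp: linked_def less_Suc_eq)

text \<open>
  Here \<open>d t\<close> says that the edge \<open>{t, t + 1}\<close> is deleted; a block is a cell of the path on \<open>{..i}\<close>.
\<close>

primrec block_sum :: "(nat \<Rightarrow> real) \<Rightarrow> (nat \<Rightarrow> bool) \<Rightarrow> nat \<Rightarrow> real" where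
  "block_sum z d 0 = z 0"
| "block_sum z d (Suc i) = z (Suc i) + (if d i then 0 else block_sum z d i)"

primrec block_energy :: "(nat \<Rightarrow> real) \<Rightarrow> (nat \<Rightarrow> bool) \<Rightarrow> nat \<Rightarrow> real" where
  "block_energy z d 0 = (z 0)\<^sup>2"
| "block_energy z d (Suc i) = block_energy z d i + (z (Suc i))\<^sup>2 +
     (if d i then 0 else 2 * z (Suc i) * block_sum z d i)"

lemma block_sum_eq: "block_sum z d i = (\<Sum>x\<le>i. z x * of_bool (linked d x i))"
proof (induction i)
  case (Suc i)
  have "(\<Sum>x\<le>i. z x * of_bool (linked d x (Suc i))) =
      (\<Sum>x\<le>i. if d i then 0 else z x * of_bool (linked d x i))"
    by (intro sum.cong refl) (simp add: linked_Suc)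
  then show ?case using Suc by simp
qed simp

text \<open>The one-step recursion serves the Markov chain; the sum over linked pairs is what can be
  compared with cells.\<close>

lemma block_energy_eq:
  "block_energy z d i = (\<Sum>x\<le>i. \<Sum>y\<le>i. z x * z y * of_bool (linked d x y))"
proof (induction i)
  case (Suc i)
  have *: "(\<Sum>x\<le>i. z x * z (Suc i) * of_bool (linked d x (Suc i))) =
      (if d i then 0 else z (Suc i) * block_sum z d i)"
    by (auto simp: block_sum_eq sum_distrib_left linked_Suc intro!: sum.cong)
  have "(\<Sum>y\<le>i. z (Suc i) * z y * of_bool (linked d (Suc i) y)) =
      (if d i then 0 else z (Suc i) * block_sum z d i)"
    unfolding *[symmetric] by (intro sum.cong) (auto simp: linked_sym[of d "Suc i"])
  then show ?case using Suc * by (simp add: sum.distrib power2_eq_square)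
qed (simp add: power2_eq_square)

text \<open>Values at \<open>i\<close> read only the cuts below \<open>i\<close>. Hence the cut
  split off by \<open>expectation_cuts_Suc\<close> is independent of the block sum and energy built
  so far.\<close>

lemma block_sum_upd: "i \<le> j \<Longrightarrow> block_sum z (d(j := b)) i = block_sum z d i"
  by (induction i) auto

lemma block_energy_upd: "i \<le> j \<Longrightarrow> block_energy z (d(j := b)) i = block_energy z d i"
  by (induction i) (auto simp: block_sum_upd)

text \<open>The energy is the sum of the squared masses of all blocks, and the last block is one of
  them.\<close>

lemma block_energy_ge: "(block_sum z d i)\<^sup>2 \<le> block_energy z d i"
  by (induction i) (auto simp: power2_eq_square algebra_simps intro: order_trans[OF zero_le_square])

section \<open>Mean of the energy under independent cuts\<close>

definition cuts :: "real \<Rightarrow> nat \<Rightarrow> (nat \<Rightarrow> bool) pmf" where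
  "cuts \<rho> i = Pi_pmf {..<i} False (\<lambda>_. bernoulli_pmf \<rho>)"

lemma finite_set_cuts: "finite (set_pmf (cuts \<rho> i))"
  unfolding cuts_def
  by (rule finite_subset[OF set_Pi_pmf_subset'])
     (auto intro!: finite_PiE_dflt intro: finite_subset[OF subset_UNIV])

lemma integrable_cuts [simp]: "integrable (measure_pmf (cuts \<rho> i)) (f :: _ \<Rightarrow> real)"
  by (intro integrable_measure_pmf_finite finite_set_cuts)

lemma expectation_cuts_Suc:
  assumes "0 \<le> \<rho>" "\<rho> \<le> 1"
  shows "measure_pmf.expectation (cuts \<rho> (Suc i)) f =
    (1 - \<rho>) * measure_pmf.expectation (cuts \<rho> i) (\<lambda>d. f (d(i := False))) +
    \<rho> * measure_pmf.expectation (cuts \<rho> i) (\<lambda>d. f (d(i := True)) :: real)"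
proof -
  have "cuts \<rho> (Suc i) = bind_pmf (bernoulli_pmf \<rho>) (\<lambda>y. map_pmf (\<lambda>d. d(i := y)) (cuts \<rho> i))"
    unfolding cuts_def by (simp add: lessThan_Suc Pi_pmf_insert' map_pmf_def)
  then show ?thesis
    using assms
    by (simp, subst pmf_expectation_bind[of UNIV]) (auto simp: finite_set_cuts UNIV_bool)
qed

primrec mean_sum :: "(nat \<Rightarrow> real) \<Rightarrow> real \<Rightarrow> nat \<Rightarrow> real" where
  "mean_sum z \<rho> 0 = z 0"
| "mean_sum z \<rho> (Suc i) = z (Suc i) + (1 - \<rho>) * mean_sum z \<rho> i"

definition mean_energy :: "(nat \<Rightarrow> real) \<Rightarrow> real \<Rightarrow> nat \<Rightarrow> real" where
  "mean_energy z \<rho> i = measure_pmf.expectation (cuts \<rho> i) (\<lambda>d. block_energy z d i)"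

context
  fixes \<rho> :: real assumes \<rho>: "0 \<le> \<rho>" "\<rho> \<le> 1"
begin

lemma expectation_block_sum:
  "measure_pmf.expectation (cuts \<rho> i) (\<lambda>d. block_sum z d i) = mean_sum z \<rho> i"
proof (induction i)
  case (Suc i)
  then show ?case
    by (simp add: expectation_cuts_Suc[OF \<rho>] block_sum_upd algebra_simps)
qed (simp add: cuts_def)

lemma mean_energy_Suc:
  "mean_energy z \<rho> (Suc i) = mean_energy z \<rho> i + (z (Suc i))\<^sup>2 + 2 * (1 - \<rho>) * z (Suc i) * mean_sum z \<rho> i"
  unfolding mean_energy_def
  by (simp add: expectation_cuts_Suc[OF \<rho>] block_sum_upd block_energy_upd expectation_block_sum algebra_simps)

text \<open>With \<open>s = mean_sum z \<rho>\<close> and \<open>q = 1 - \<rho>\<close>, the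
  increment in \<open>mean_energy_Suc\<close> equals
  \<open>s (Suc N)\<^sup>2 - q\<^sup>2 * s N\<^sup>2\<close>, so the recursion sums up by
  induction.\<close>

lemma mean_energy_eq:
  "mean_energy z \<rho> N = (1 - (1 - \<rho>)\<^sup>2) * (\<Sum>i<N. (mean_sum z \<rho> i)\<^sup>2) + (mean_sum z \<rho> N)\<^sup>2"
proof (induction N)
  case (Suc N)
  then show ?case by (simp add: mean_energy_Suc algebra_simps power2_eq_square)
qed (simp add: mean_energy_def cuts_def)

section \<open>Variance of the energy\<close>

text \<open>The difference is the energy of the blocks already closed. It grows by the square of the
  current block exactly when the cut at \<open>i\<close> closes that block; the martingale variance
  is charged to this growth.\<close>

lemma expectation_energy_gap_Suc:
  "measure_pmf.expectation (cuts \<rho> (Suc i)) (\<lambda>d. block_energy z d (Suc i) - (block_sum z d (Suc i))\<^sup>2) =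
   measure_pmf.expectation (cuts \<rho> i) (\<lambda>d. block_energy z d i - (block_sum z d i)\<^sup>2) +
   \<rho> * measure_pmf.expectation (cuts \<rho> i) (\<lambda>d. (block_sum z d i)\<^sup>2)"
  by (simp add: expectation_cuts_Suc[OF \<rho>] block_sum_upd block_energy_upd power2_eq_square algebra_simps)

text \<open>
  With \<open>R i\<close> the expected mass linked to \<open>i\<close> from the right, the conditional expectation of
  the final energy given the first \<open>i\<close> cuts is \<open>energy + 2 (1 - \<rho>) R (i + 1) sum\<close> up to a
  constant; this is a martingale with explicit increments.
\<close>

lemma energy_martingale_variance:
  assumes R: "\<And>j. R j = z j + (1 - \<rho>) * R (Suc j)" and B: "\<And>j. (R j)\<^sup>2 \<le> B"
  defines "W \<equiv> (\<lambda>i d. block_energy z d i + 2 * (1 - \<rho>) * R (Suc i) * block_sum z d i)"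
  shows "measure_pmf.expectation (cuts \<rho> i)
      (\<lambda>d. (W i d - measure_pmf.expectation (cuts \<rho> i) (W i))\<^sup>2) \<le>
    4 * B * measure_pmf.expectation (cuts \<rho> i) (\<lambda>d. block_energy z d i - (block_sum z d i)\<^sup>2)"
proof (induction i)
  case 0
  then show ?case by (simp add: W_def cuts_def)
next
  case (Suc i)
  let ?E = "\<lambda>i. measure_pmf.expectation (cuts \<rho> i)"
  define w where "w = ?E i (W i)"
  define c where "c = (z (Suc i))\<^sup>2 + 2 * (1 - \<rho>) * z (Suc i) * R (Suc (Suc i))"
  define r where "r = R (Suc i)"
  have r: "z (Suc i) = r - (1 - \<rho>) * R (Suc (Suc i))"
    using R[of "Suc i"] by (simp add: r_def)
  \<comment> \<open>The new cut enters only through the centred variable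
    \<open>of_bool (\<not> b) - (1 - \<rho>)\<close>. So \<open>W\<close> drifts by the constant
    \<open>c\<close>, and the mixed terms cancel when the square is averaged over the cut.\<close>
  have W_upd: "W (Suc i) (d(i := b)) = W i d + c + 2 * (of_bool (\<not> b) - (1 - \<rho>)) * r * block_sum z d i" for d b
    unfolding W_def c_def r_def[symmetric]
    by (simp add: block_sum_upd block_energy_upd r power2_eq_square algebra_simps)
  have w': "?E (Suc i) (W (Suc i)) = w + c"
    unfolding expectation_cuts_Suc[OF \<rho>] W_upd w_def
    by (simp add: W_def algebra_simps)
  have "?E (Suc i) (\<lambda>d. (W (Suc i) d - (w + c))\<^sup>2) =
    (1 - \<rho>) * ?E i (\<lambda>d. (W i d - w + 2 * \<rho> * r * block_sum z d i)\<^sup>2) +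
    \<rho> * ?E i (\<lambda>d. (W i d - w - 2 * (1 - \<rho>) * r * block_sum z d i)\<^sup>2)"
    unfolding expectation_cuts_Suc[OF \<rho>] W_upd by (simp add: algebra_simps)
  also have "\<dots> = ?E i (\<lambda>d. (1 - \<rho>) * (W i d - w + 2 * \<rho> * r * block_sum z d i)\<^sup>2 +
      \<rho> * (W i d - w - 2 * (1 - \<rho>) * r * block_sum z d i)\<^sup>2)"
    by simp
  also have "\<dots> = ?E i (\<lambda>d. (W i d - w)\<^sup>2 + 4 * \<rho> * (1 - \<rho>) * r\<^sup>2 * (block_sum z d i)\<^sup>2)"
    by (intro arg_cong[where f = "?E i"] ext) (simp add: power2_eq_square algebra_simps)
  also have "\<dots> = ?E i (\<lambda>d. (W i d - w)\<^sup>2) + 4 * \<rho> * (1 - \<rho>) * r\<^sup>2 * ?E i (\<lambda>d. (block_sum z d i)\<^sup>2)"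
    by simp
  \<comment> \<open>The variance of one increment is at most \<open>4 * B\<close> times the expected
    growth of the closed energy.\<close>
  also have "\<dots> \<le> 4 * B * ?E i (\<lambda>d. block_energy z d i - (block_sum z d i)\<^sup>2) +
      4 * \<rho> * B * ?E i (\<lambda>d. (block_sum z d i)\<^sup>2)"
  proof (intro add_mono mult_right_mono)
    show "?E i (\<lambda>d. (W i d - w)\<^sup>2) \<le> 4 * B * ?E i (\<lambda>d. block_energy z d i - (block_sum z d i)\<^sup>2)"
      unfolding w_def by (rule Suc.IH)
    have "(1 - \<rho>) * r\<^sup>2 \<le> 1 * B" using \<rho> B[of "Suc i"] by (intro mult_mono) (auto simp: r_def)
    then show "4 * \<rho> * (1 - \<rho>) * r\<^sup>2 \<le> 4 * \<rho> * B"
      using \<rho> mult_left_mono[of "(1 - \<rho>) * r\<^sup>2" B "4 * \<rho>"] by (simp add: mult.assoc)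
  qed auto
  also have "\<dots> = 4 * B * ?E (Suc i) (\<lambda>d. block_energy z d (Suc i) - (block_sum z d (Suc i))\<^sup>2)"
    unfolding expectation_energy_gap_Suc by (simp add: algebra_simps)
  finally show ?case unfolding w' .
qed

text \<open>At the right end of the path \<open>R\<close> vanishes, so the martingale ends in the
  energy itself.\<close>

lemma block_energy_variance:
  assumes R: "\<And>j. R j = z j + (1 - \<rho>) * R (Suc j)" and B: "\<And>j. (R j)\<^sup>2 \<le> B" and "R (Suc N) = 0"
  shows "measure_pmf.expectation (cuts \<rho> N) (\<lambda>d. (block_energy z d N - mean_energy z \<rho> N)\<^sup>2)
    \<le> 4 * B * mean_energy z \<rho> N"
proof -
  have "B \<ge> 0" using B[of 0] by (rule order_trans[OF zero_le_power2])
  have "measure_pmf.expectation (cuts \<rho> N) (\<lambda>d. (block_energy z d N - mean_energy z \<rho> N)\<^sup>2)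
    \<le> 4 * B * measure_pmf.expectation (cuts \<rho> N) (\<lambda>d. block_energy z d N - (block_sum z d N)\<^sup>2)"
    using energy_martingale_variance[where R = R and z = z and i = N, OF R B] \<open>R (Suc N) = 0\<close> by (simp add: mean_energy_def)
  also have "\<dots> \<le> 4 * B * mean_energy z \<rho> N"
    using \<open>B \<ge> 0\<close> unfolding mean_energy_def
    by (intro mult_left_mono integral_mono) auto
  finally show ?thesis .
qed

section \<open>Energy of perturbations of a constant\<close>

lemma mean_sum_add: "mean_sum (\<lambda>i. a i + b i) \<rho> N = mean_sum a \<rho> N + mean_sum b \<rho> N"
  by (induction N) (auto simp: algebra_simps)

lemma mean_energy_nonneg: "mean_energy z \<rho> N \<ge> 0"
  unfolding mean_energy_def
  by (intro Bochner_Integration.integral_nonneg) (auto intro: order_trans[OF zero_le_power2 block_energy_ge])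

text \<open>Each \<open>z i\<close> is a difference of consecutive mean sums, the earlier one scaled
  by \<open>1 - \<rho>\<close>, so its square is at most twice the sum of their squares. The factor
  \<open>1 - (1 - \<rho>)\<^sup>2 \<ge> \<rho>\<close> of the diagonal form then gives the
  bound.\<close>

lemma mean_energy_lower: "\<rho> / 4 * (\<Sum>i\<le>N. (z i)\<^sup>2) \<le> mean_energy z \<rho> N"
proof -
  let ?s = "mean_sum z \<rho>"
  have 0: "(\<Sum>i\<le>N. (z i)\<^sup>2) \<le> 4 * (\<Sum>i<N. (?s i)\<^sup>2) + 2 * (?s N)\<^sup>2"
  proof (induction N)
    case (Suc N)
    have q: "(1 - \<rho>)\<^sup>2 * (?s N)\<^sup>2 \<le> 1 * (?s N)\<^sup>2" using \<rho> by (intro mult_right_mono) (auto simp: power_le_one)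
    have "(z (Suc N))\<^sup>2 = (?s (Suc N) - (1 - \<rho>) * ?s N)\<^sup>2" by simp
    also have "\<dots> \<le> 2 * (?s (Suc N))\<^sup>2 + 2 * ((1 - \<rho>) * ?s N)\<^sup>2"
      using zero_le_power2[of "?s (Suc N) + (1 - \<rho>) * ?s N"]
      by (simp only: power2_diff power2_sum)
    finally have "(z (Suc N))\<^sup>2 \<le> 2 * (?s (Suc N))\<^sup>2 + 2 * (?s N)\<^sup>2"
      using q by (simp add: power_mult_distrib)
    then show ?case using Suc by (simp del: mean_sum.simps(2))
  qed auto
  have "\<rho> / 4 * (\<Sum>i\<le>N. (z i)\<^sup>2) \<le> \<rho> / 4 * (4 * (\<Sum>i<N. (?s i)\<^sup>2) + 2 * (?s N)\<^sup>2)"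
    using 0 \<rho> by (intro mult_left_mono) auto
  also have "\<dots> \<le> mean_energy z \<rho> N"
  proof -
    have "\<rho> * (\<Sum>i<N. (?s i)\<^sup>2) \<le> (1 - (1 - \<rho>)\<^sup>2) * (\<Sum>i<N. (?s i)\<^sup>2)"
      using \<rho> mult_left_le[of \<rho> \<rho>]
      by (intro mult_right_mono sum_nonneg) (auto simp: power2_eq_square algebra_simps)
    moreover have "\<rho> / 2 * (?s N)\<^sup>2 \<le> 1 * (?s N)\<^sup>2"
      using \<rho> by (intro mult_right_mono) auto
    ultimately show ?thesis unfolding mean_energy_eq by (simp add: algebra_simps)
  qed
  finally show ?thesis .
qed

lemma mean_sum_const:
  assumes "\<rho> > 0"
  shows "mean_sum (\<lambda>_. a) \<rho> i = a / \<rho> * (1 - (1 - \<rho>) ^ Suc i)"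
proof (induction i)
  case (Suc i)
  have "mean_sum (\<lambda>_. a) \<rho> (Suc i) = a + (1 - \<rho>) * (a / \<rho> * (1 - (1 - \<rho>) ^ Suc i))"
    using Suc by simp
  also have "\<dots> = a / \<rho> * (\<rho> + (1 - \<rho>) * (1 - (1 - \<rho>) ^ Suc i))"
    using assms by (simp add: field_simps)
  also have "\<rho> + (1 - \<rho>) * (1 - (1 - \<rho>) ^ Suc i) = 1 - (1 - \<rho>) ^ Suc (Suc i)"
    by (simp add: algebra_simps)
  finally show ?case .
qed (use assms in simp)

text \<open>Every mean sum has absolute value at most that of \<open>a / \<rho>\<close>, and
  \<open>1 - (1 - \<rho>)\<^sup>2 \<le> 2 * \<rho>\<close>.\<close>

lemma mean_energy_const:
  assumes "\<rho> > 0"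
  shows "mean_energy (\<lambda>_. a) \<rho> N \<le> 2 * (a / \<rho>)\<^sup>2 * (\<rho> * real N + 1)"
proof -
  have *: "(mean_sum (\<lambda>_. a) \<rho> i)\<^sup>2 \<le> (a / \<rho>)\<^sup>2" for i
  proof -
    have "(1 - (1 - \<rho>) ^ Suc i)\<^sup>2 \<le> 1"
      using \<rho> by (intro power_le_one) (auto simp del: power_Suc intro!: power_le_one)
    then have "(a / \<rho>)\<^sup>2 * (1 - (1 - \<rho>) ^ Suc i)\<^sup>2 \<le> (a / \<rho>)\<^sup>2 * 1" by (intro mult_left_mono) auto
    then show ?thesis unfolding mean_sum_const[OF assms] by (simp only: power_mult_distrib)
  qed
  have "mean_energy (\<lambda>_. a) \<rho> N \<le> (2 * \<rho>) * (\<Sum>i<N. (a / \<rho>)\<^sup>2) + (a / \<rho>)\<^sup>2"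
    unfolding mean_energy_eq using *
    by (intro add_mono mult_mono sum_mono sum_nonneg) (auto simp: power2_eq_square algebra_simps assms less_imp_le)
  also have "\<dots> = 2 * (a / \<rho>)\<^sup>2 * (\<rho> * real N) + 1 * (a / \<rho>)\<^sup>2" by simp
  also have "\<dots> \<le> 2 * (a / \<rho>)\<^sup>2 * (\<rho> * real N) + 2 * (a / \<rho>)\<^sup>2" by (intro add_left_mono mult_right_mono) auto
  finally show ?thesis by (simp add: algebra_simps)
qed

text \<open>
  For a perturbation \<open>z\<close> of total mass \<open>0\<close> the cross term with the constant only sees the two
  end points of the path, so that completing squares loses only \<open>O((a / \<rho>)\<^sup>2)\<close>.
\<close>

lemma mean_energy_perturb:
  assumes "\<rho> > 0" and z: "(\<Sum>i\<le>N. z i) = 0" and "a \<ge> 0"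
  shows "mean_energy (\<lambda>i. a + z i) \<rho> N \<ge>
    mean_energy (\<lambda>_. a) \<rho> N + mean_energy z \<rho> N / 2 - 10 * (a / \<rho>)\<^sup>2"
proof -
  define q where "q = 1 - \<rho>"
  have q: "0 \<le> q" "q \<le> 1" "q = 1 - \<rho>" using \<rho> by (auto simp: q_def)
  define P where "P = a / \<rho>"
  let ?s = "mean_sum z \<rho>"
  let ?u = "mean_sum (\<lambda>_. a) \<rho>"
  have u: "?u i = P * (1 - q ^ Suc i)" for i
    using mean_sum_const[OF assms(1), of a i] by (simp add: P_def q_def)
  \<comment> \<open>Summing \<open>z i = ?s i - q * ?s (i - 1)\<close> telescopes: the interior of
    the cross term is governed by the total mass, hence reduces to the right end point.\<close>
  have "(\<Sum>i\<le>N. z i) = \<rho> * (\<Sum>i<N. ?s i) + ?s N"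
    by (induction N) (auto simp: algebra_simps)
  then have s0: "\<rho> * (\<Sum>i<N. ?s i) = - ?s N" using z by simp
  define C where "C = (1 - q\<^sup>2) * (\<Sum>i<N. ?u i * ?s i) + ?u N * ?s N"
  have me: "mean_energy (\<lambda>i. a + z i) \<rho> N =
      mean_energy (\<lambda>_. a) \<rho> N + 2 * C + mean_energy z \<rho> N"
    unfolding mean_energy_eq mean_sum_add C_def q_def power2_sum
    by (simp add: sum.distrib algebra_simps sum_distrib_left)
  have us: "(\<Sum>i<N. ?u i * ?s i) = P * (\<Sum>i<N. ?s i) - P * (\<Sum>i<N. q ^ Suc i * ?s i)"
    unfolding u by (simp add: sum_distrib_left algebra_simps sum_subtractf)
  have "(1 - q\<^sup>2) * (P * S1 - P * S2) + P * (1 - qN) * sN =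
      (1 + q) * P * (\<rho> * S1) - (1 - q\<^sup>2) * P * S2 + P * (1 - qN) * sN" for S1 S2 qN sN
    by (simp add: q_def power2_eq_square algebra_simps)
  then have "C = (1 + q) * P * (\<rho> * (\<Sum>i<N. ?s i)) - (1 - q\<^sup>2) * P * (\<Sum>i<N. q ^ Suc i * ?s i)
        + P * (1 - q ^ Suc N) * ?s N"
    unfolding C_def us u[of N] .
  \<comment> \<open>What remains is \<open>?s N\<close> at the right end and, near the left end, the
    \<open>?s i\<close> damped by \<open>q ^ Suc i\<close>, because there \<open>?u i\<close> is
    still away from its limit \<open>P\<close>.\<close>
  then have C: "2 * C = - (2 * P * (q + q ^ Suc N) * ?s N) - (1 - q\<^sup>2) * (\<Sum>i<N. 2 * P * q ^ Suc i * ?s i)"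
  proof -
    assume C: "C = (1 + q) * P * (\<rho> * (\<Sum>i<N. ?s i)) - (1 - q\<^sup>2) * P * (\<Sum>i<N. q ^ Suc i * ?s i)
        + P * (1 - q ^ Suc N) * ?s N"
    have *: "(\<Sum>i<N. 2 * P * q ^ Suc i * ?s i) = 2 * P * (\<Sum>i<N. q ^ Suc i * ?s i)"
      by (simp add: sum_distrib_left mult_ac)
    show ?thesis unfolding C s0 * by (simp add: algebra_simps del: power_Suc)
  qed
  have geo: "(1 - q\<^sup>2) * (\<Sum>i<N. (q ^ Suc i)\<^sup>2) \<le> 1"
  proof -
    have "(1 - q\<^sup>2) * (\<Sum>i<N. (q ^ Suc i)\<^sup>2) = q\<^sup>2 - (q ^ N * q ^ N) * q\<^sup>2"
    proof (induction N)
      case (Suc N)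
      show ?case unfolding sum.lessThan_Suc distrib_left Suc by (simp add: algebra_simps power2_eq_square)
    qed simp
    also have "\<dots> \<le> 1 - 0" using q by (intro diff_mono) (auto simp: power_le_one)
    finally show ?thesis by simp
  qed
  \<comment> \<open>Weighted so that the \<open>?s\<close> parts cost exactly half of
    \<open>mean_energy z \<rho> N\<close>. The other parts cost \<open>8 * P\<^sup>2\<close> at the
    right end and \<open>2 * P\<^sup>2\<close> at the left end, whence the
    \<open>10\<close>.\<close>
  have t: "2 * x * y \<le> 2 * x\<^sup>2 + y\<^sup>2 / 2" for x y :: real
    using zero_le_power2[of "2 * x - y"] by (simp add: power2_eq_square algebra_simps)
  have "2 * (P * (q + q ^ Suc N)) * ?s N \<le> 2 * (P * (q + q ^ Suc N))\<^sup>2 + (?s N)\<^sup>2 / 2" by (rule t)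
  also have "(P * (q + q ^ Suc N))\<^sup>2 \<le> P\<^sup>2 * 4"
  proof -
    have "q + q ^ Suc N \<le> 2" using q power_le_one[of q "Suc N"] by linarith
    then have "(q + q ^ Suc N)\<^sup>2 \<le> 2\<^sup>2" using q by (intro power_mono) auto
    then show ?thesis unfolding power_mult_distrib by (intro mult_left_mono) auto
  qed
  finally have 1: "2 * P * (q + q ^ Suc N) * ?s N \<le> 8 * P\<^sup>2 + (?s N)\<^sup>2 / 2" by (simp add: mult_ac)
  have "(1 - q\<^sup>2) * (\<Sum>i<N. 2 * P * q ^ Suc i * ?s i) \<le>
      (1 - q\<^sup>2) * (\<Sum>i<N. 2 * P\<^sup>2 * (q ^ Suc i)\<^sup>2 + (?s i)\<^sup>2 / 2)"
  proof (intro mult_left_mono sum_mono)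
    show "2 * P * q ^ Suc i * ?s i \<le> 2 * P\<^sup>2 * (q ^ Suc i)\<^sup>2 + (?s i)\<^sup>2 / 2" for i
      using t[of "P * q ^ Suc i" "?s i"] by (simp only: power_mult_distrib mult.assoc)
  qed (use q in \<open>simp add: power_le_one\<close>)
  also have "\<dots> = 2 * P\<^sup>2 * ((1 - q\<^sup>2) * (\<Sum>i<N. (q ^ Suc i)\<^sup>2)) + (1 - q\<^sup>2) * (\<Sum>i<N. (?s i)\<^sup>2) / 2"
    by (simp add: sum.distrib sum_distrib_left sum_divide_distrib algebra_simps)
  also have "\<dots> \<le> 2 * P\<^sup>2 * 1 + (1 - q\<^sup>2) * (\<Sum>i<N. (?s i)\<^sup>2) / 2"
    by (intro add_right_mono mult_left_mono geo) auto
  finally have 2: "(1 - q\<^sup>2) * (\<Sum>i<N. 2 * P * q ^ Suc i * ?s i) \<le>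
      2 * P\<^sup>2 + (1 - q\<^sup>2) * (\<Sum>i<N. (?s i)\<^sup>2) / 2" by simp
  have "2 * C \<ge> - 10 * P\<^sup>2 - mean_energy z \<rho> N / 2"
  proof -
    have *: "X \<le> 8 * p + t / 2 \<Longrightarrow> Z \<le> 2 * p + S / 2 \<Longrightarrow> - 10 * p - (S + t) / 2 \<le> - X - Z"
      for X Z S t p :: real by (simp add: field_simps)
    show ?thesis unfolding C mean_energy_eq q(3)[symmetric] by (rule *[OF 1 2])
  qed
  then show ?thesis unfolding me P_def[symmetric] by linarith
qed

end

section \<open>Cells of the path and of the cycle\<close>

text \<open>Positions from \<open>n - 1\<close> on count as not cut, matching the default
  \<open>False\<close> of \<open>Pi_pmf\<close> in \<open>cuts\<close>; otherwise the two
  distributions could not be equal as distributions of functions.\<close>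

definition path_cuts :: "nat \<Rightarrow> nat set set \<Rightarrow> nat \<Rightarrow> bool" where
  "path_cuts n H t \<longleftrightarrow> t < n - 1 \<and> {t, t + 1} \<notin> H"

lemma cell_of_eq_iff:
  "cell_of H x = cell_of H y \<longleftrightarrow> (x, y) \<in> {(u, v). {u, v} \<in> H}\<^sup>*"
proof -
  let ?R = "{(u, v). {u, v} \<in> H}\<^sup>*"
  have "sym {(u, v). {u, v} \<in> H}" by (auto simp: sym_def insert_commute)
  then have s: "sym ?R" by (rule sym_rtrancl)
  show ?thesis
  proof
    assume "cell_of H x = cell_of H y"
    moreover have "y \<in> cell_of H y" by (simp add: cell_of_def)
    ultimately show "(x, y) \<in> ?R" by (auto simp: cell_of_def)
  next
    assume "(x, y) \<in> ?R"
    moreover from this s have "(y, x) \<in> ?R" by (auto dest: symD)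
    ultimately show "cell_of H x = cell_of H y"
      by (auto simp: cell_of_def intro: rtrancl_trans)
  qed
qed

lemma mem_cell_of_iff: "y \<in> cell_of H x \<longleftrightarrow> cell_of H x = cell_of H y"
  by (simp add: cell_of_eq_iff) (simp add: cell_of_def)

lemma same_cell_if_linked_le:
  assumes "x \<le> y" "y < n" "linked (path_cuts n H) x y"
  shows "cell_of H x = cell_of H y"
  using assms
proof (induction y rule: dec_induct)
  case (step w)
  then have "linked (path_cuts n H) x w" "\<not> path_cuts n H w" by (auto simp: linked_Suc)
  then have "cell_of H x = cell_of H w" and "{w, Suc w} \<in> H"
    using step.IH step.prems(1) by (simp, simp add: path_cuts_def)
  moreover from this(2) have "cell_of H w = cell_of H (Suc w)" by (auto simp: cell_of_eq_iff)
  ultimately show ?case by simp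
qed auto

lemma same_cell_if_linked:
  assumes "x < n" "y < n" "linked (path_cuts n H) x y"
  shows "cell_of H x = cell_of H y"
proof (cases "x \<le> y")
  case True
  then show ?thesis using assms(2,3) by (rule same_cell_if_linked_le)
next
  case False
  have "linked (path_cuts n H) y x" using assms(3) by (subst linked_sym)
  then show ?thesis using False assms(1) same_cell_if_linked_le[of y x n H] by simp
qed

text \<open>Closing the path to a cycle can only merge the block of \<open>0\<close> with the block of \<open>n - 1\<close>.\<close>

lemma linked_if_same_cell:
  assumes H: "H \<subseteq> cycle_edges n" and "x < n" and eq: "cell_of H x = cell_of H y"
  defines "d \<equiv> path_cuts n H"
  shows "y < n \<and> (linked d x y \<or> linked d x 0 \<and> linked d (n - 1) y \<or> linked d x (n - 1) \<and> linked d 0 y)"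
proof -
  have "(x, y) \<in> {(u, v). {u, v} \<in> H}\<^sup>*" using eq by (simp add: cell_of_eq_iff)
  then show ?thesis
  proof (induction rule: rtrancl_induct)
    case base
    then show ?case using \<open>x < n\<close> by simp
  next
    case (step y z)
    then have e: "{y, z} \<in> H" by simp
    then have "{y, z} \<in> cycle_edges n" using H by blast
    then consider "{y, z} = {n - 1, 0}" | i where "{y, z} = {i, i + 1}" "i + 1 < n"
      by (auto simp: cycle_edges_def path_edges_def)
    then show ?case
    proof cases
      case 1
      then have "y = n - 1 \<and> z = 0 \<or> y = 0 \<and> z = n - 1" by (auto simp: doubleton_eq_iff)
      then show ?thesis using step.IH \<open>x < n\<close> by auto
    next
      case 2
      then have "\<not> d i" using e by (auto simp: d_def path_cuts_def)
      then have l: "linked d i (i + 1)" by (simp add: linked_Suc)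
      then have l': "linked d (i + 1) i" by (subst linked_sym)
      have "y = i \<and> z = i + 1 \<or> y = i + 1 \<and> z = i" using 2 by (auto simp: doubleton_eq_iff)
      then have "linked d y z" "z < n" using l l' 2(2) by (elim disjE; simp)+
      moreover from \<open>linked d y z\<close> have "linked d a y \<Longrightarrow> linked d a z" for a by (rule linked_trans[rotated])
      ultimately show ?thesis using step.IH by blast
    qed
  qed
qed

text \<open>For \<open>z = pmf \<mu>\<close> this is the sum of the squared cell masses. Over pairs
  it is linear in the same-cell indicators, so its mean involves only \<open>same_cell_prob\<close>,
  and for nonnegative \<open>z\<close> it is monotone in the same-cell relation.\<close>

definition energy :: "nat \<Rightarrow> (nat \<Rightarrow> real) \<Rightarrow> nat set set \<Rightarrow> real" where
  "energy n z H = (\<Sum>x<n. \<Sum>y<n. z x * z y * of_bool (cell_of H x = cell_of H y))"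

lemma block_energy_eq': "n > 0 \<Longrightarrow>
    block_energy z d (n - 1) = (\<Sum>x<n. \<Sum>y<n. z x * z y * of_bool (linked d x y))"
  using lessThan_Suc_atMost[of "n - 1"] by (simp add: block_energy_eq)

lemma block_energy_le_energy:
  assumes "n > 0" "\<And>x. z x \<ge> 0"
  shows "block_energy z (path_cuts n H) (n - 1) \<le> energy n z H"
  unfolding block_energy_eq'[OF assms(1)] energy_def
  using assms(2) by (intro sum_mono mult_left_mono) (auto dest: same_cell_if_linked)

text \<open>A pair joined only by the closing edge has one point in the block of \<open>0\<close>
  and the other in the block of \<open>n - 1\<close>; these pairs contribute at most twice the
  product of the two block masses.\<close>

lemma energy_le_block_energy:
  assumes "H \<subseteq> cycle_edges n" "n > 0" "\<And>x. z x \<ge> 0"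
    and A: "\<And>x. x < n \<Longrightarrow> (\<Sum>y<n. z y * of_bool (linked (path_cuts n H) x y)) \<le> A"
  shows "energy n z H \<le> block_energy z (path_cuts n H) (n - 1) + 2 * A\<^sup>2"
proof -
  let ?l = "linked (path_cuts n H)"
  define F where "F = (\<Sum>y<n. z y * of_bool (?l 0 y))"
  define G where "G = (\<Sum>y<n. z y * of_bool (?l (n - 1) y))"
  have FG: "0 \<le> F" "F \<le> A" "0 \<le> G" "G \<le> A"
    unfolding F_def G_def using assms by (auto intro!: sum_nonneg)
  have "energy n z H \<le> (\<Sum>x<n. \<Sum>y<n. z x * z y * of_bool (?l x y) +
      (z x * of_bool (?l 0 x)) * (z y * of_bool (?l (n - 1) y)) +
      (z x * of_bool (?l (n - 1) x)) * (z y * of_bool (?l 0 y)))"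
    unfolding energy_def
  proof (intro sum_mono)
    fix x y assume "x \<in> {..<n}" "y \<in> {..<n}"
    then show "z x * z y * of_bool (cell_of H x = cell_of H y) \<le>
      z x * z y * of_bool (?l x y) + (z x * of_bool (?l 0 x)) * (z y * of_bool (?l (n - 1) y)) +
      (z x * of_bool (?l (n - 1) x)) * (z y * of_bool (?l 0 y))"
      using linked_if_same_cell[OF assms(1), of x y] assms(3)[of x] assms(3)[of y]
        linked_sym[THEN iffD1, of "path_cuts n H" x 0] linked_sym[THEN iffD1, of "path_cuts n H" x "n - 1"]
      by (cases "cell_of H x = cell_of H y") auto
  qed
  also have "\<dots> = block_energy z (path_cuts n H) (n - 1) + F * G + G * F"
    unfolding block_energy_eq'[OF assms(2)] F_def G_def sum_product by (simp add: sum.distrib)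
  also have "F * G \<le> A * A" using FG by (intro mult_mono) auto
  also have "G * F \<le> A * A" using FG by (intro mult_mono) auto
  finally show ?thesis by (simp add: power2_eq_square)
qed

lemma cell_mass_le:
  fixes z :: "nat \<Rightarrow> real"
  assumes "H \<subseteq> cycle_edges n" "n > 0" "\<And>x. z x \<ge> 0" "x < n"
    and A: "\<And>x. x < n \<Longrightarrow> (\<Sum>y<n. z y * of_bool (linked (path_cuts n H) x y)) \<le> A"
  shows "(\<Sum>y<n. z y * of_bool (cell_of H x = cell_of H y)) \<le> 2 * A"
proof -
  let ?l = "linked (path_cuts n H)"
  \<comment> \<open>The only block that can be merged with that of \<open>x\<close>: if
    \<open>x\<close> lies in the block of \<open>0\<close>, it is the block of \<open>n - 1\<close>,
    otherwise it can only be the block of \<open>0\<close>.\<close>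
  define w where "w = (if ?l x 0 then n - 1 else 0)"
  have "(\<Sum>y<n. z y * of_bool (cell_of H x = cell_of H y)) \<le>
     (\<Sum>y<n. z y * of_bool (?l x y) + z y * of_bool (?l w y))"
  proof (intro sum_mono)
    fix y assume "y \<in> {..<n}"
    have "?l x y" if "?l x 0" "?l 0 y" using that linked_trans by blast
    then show "z y * of_bool (cell_of H x = cell_of H y) \<le> z y * of_bool (?l x y) + z y * of_bool (?l w y)"
      using linked_if_same_cell[OF assms(1,4), of y] assms(3) by (auto simp: w_def)
  qed
  also have "\<dots> \<le> A + A"
    unfolding sum.distrib using assms by (intro add_mono A) (auto simp: w_def)
  finally show ?thesis by simp
qed

lemma finite_path_edges: "finite (path_edges n)"
proof -
  have "path_edges n = (\<lambda>i. {i, i + 1}) ` {..<n - 1}" by (auto simp: path_edges_def)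
  then show ?thesis by simp
qed

text \<open>By independence the product distribution can be restricted to the path edges, which
  \<open>h\<close> then reindexes by their left end points. Path and cycle thus share one model of
  cuts.\<close>

lemma path_cuts_random_subgraph:
  assumes "E \<in> {path_edges n, cycle_edges n}"
  shows "map_pmf (path_cuts n) (random_subgraph E \<rho>) = cuts \<rho> (n - 1)"
proof -
  have E: "finite E" "path_edges n \<subseteq> E"
    using assms finite_path_edges by (auto simp: cycle_edges_def)
  define h where "h t = {t, t + (1::nat)}" for t
  have inj: "inj h" unfolding h_def by (auto simp: inj_on_def doubleton_eq_iff)
  have h: "bij_betw h {..<n - 1} (path_edges n)"
    using inj by (auto simp: bij_betw_def path_edges_def h_def inj_on_def)
  have hn: "h t \<notin> path_edges n" if "t \<notin> {..<n - 1}" for t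
    using that inj by (auto simp: path_edges_def h_def doubleton_eq_iff)
  have hmem: "h t \<in> path_edges n \<longleftrightarrow> t < n - 1" for t
    using hn[of t] by (auto simp: path_edges_def h_def)
  have "cuts \<rho> (n - 1) = map_pmf (\<lambda>g. g \<circ> h) (Pi_pmf (path_edges n) False (\<lambda>_. bernoulli_pmf \<rho>))"
    unfolding cuts_def by (rule Pi_pmf_bij_betw[OF _ h hn]) auto
  also have "\<dots> = map_pmf (path_cuts n) (random_subgraph E \<rho>)"
    unfolding random_subgraph_def Pi_pmf_subset[OF E] pmf.map_comp
  proof (intro map_pmf_cong refl ext)
    fix deleted t
    show "((\<lambda>g. g \<circ> h) \<circ> (\<lambda>f x. if x \<in> path_edges n then f x else False)) deleted t =
        (path_cuts n \<circ> (\<lambda>deleted. {e \<in> E. \<not> deleted e})) deleted t"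
      using E(2) hmem[of t] by (auto simp: path_cuts_def h_def)
  qed
  finally show ?thesis ..
qed

lemma random_subgraph_subset:
  assumes "E \<in> {path_edges n, cycle_edges n}" "H \<in> set_pmf (random_subgraph E \<rho>)"
  shows "H \<subseteq> cycle_edges n"
  using assms by (auto simp: random_subgraph_def cycle_edges_def)

lemma finite_set_random_subgraph:
  assumes "E \<in> {path_edges n, cycle_edges n}"
  shows "finite (set_pmf (random_subgraph E \<rho>))"
proof -
  have "finite (cycle_edges n)" using finite_path_edges by (auto simp: cycle_edges_def)
  moreover have "set_pmf (random_subgraph E \<rho>) \<subseteq> Pow (cycle_edges n)"
    using random_subgraph_subset[OF assms] by blast
  ultimately show ?thesis by (meson finite_Pow_iff finite_subset)
qed

lemma expectation_energy:
  assumes "E \<in> {path_edges n, cycle_edges n}"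
  shows "measure_pmf.expectation (random_subgraph E \<rho>) (energy n z) =
    (\<Sum>x<n. \<Sum>y<n. z x * z y * same_cell_prob E \<rho> x y)"
proof -
  have [simp]: "integrable (measure_pmf (random_subgraph E \<rho>)) (f :: _ \<Rightarrow> real)" for f
    using assms by (intro integrable_measure_pmf_finite finite_set_random_subgraph)
  have "measure_pmf.expectation (random_subgraph E \<rho>) (\<lambda>H. of_bool (cell_of H x = cell_of H y)) =
      same_cell_prob E \<rho> x y" for x y
  proof -
    have "(\<lambda>H. of_bool (cell_of H x = cell_of H y)) =
        (indicator {H. cell_of H x = cell_of H y} :: _ \<Rightarrow> real)"
      by (auto simp: fun_eq_iff indicator_def)
    then show ?thesis by (simp add: same_cell_prob_def)
  qed
  then show ?thesis
    unfolding energy_def[abs_def] by (simp del: sum_mult_of_bool_eq)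
qed

section \<open>Lengths and masses of blocks\<close>

lemma prob_linked_interval:
  assumes "0 \<le> \<rho>" "\<rho> \<le> 1" "a + k \<le> i"
  shows "measure_pmf.prob (cuts \<rho> i) {d. \<forall>t\<in>{a..<a + k}. \<not> d t} = (1 - \<rho>) ^ k"
proof -
  have "{d. \<forall>t\<in>{a..<a + k}. \<not> d t} = Pi {..<i} (\<lambda>t. if t \<in> {a..<a + k} then {False} else UNIV)"
    using assms(3) by (auto simp: Pi_def split: if_splits)
  then have "measure_pmf.prob (cuts \<rho> i) {d. \<forall>t\<in>{a..<a + k}. \<not> d t} =
      (\<Prod>t<i. measure_pmf.prob (bernoulli_pmf \<rho>) (if t \<in> {a..<a + k} then {False} else UNIV))"
    unfolding cuts_def by (simp add: measure_Pi_pmf_Pi)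
  also have "\<dots> = (\<Prod>t<i. if t \<in> {a..<a + k} then 1 - \<rho> else 1)"
    using assms by (intro prod.cong) (auto simp: measure_pmf_single)
  also have "\<dots> = (\<Prod>t\<in>{a..<a + k}. 1 - \<rho>)"
    using assms(3) by (intro prod.mono_neutral_cong_right) auto
  finally show ?thesis by simp
qed

definition long_block :: "nat \<Rightarrow> nat \<Rightarrow> (nat \<Rightarrow> bool) set" where
  "long_block n k = {d. \<exists>a. a + k < n \<and> (\<forall>t\<in>{a..<a + k}. \<not> d t)}"

lemma prob_long_block:
  assumes "0 \<le> \<rho>" "\<rho> \<le> 1"
  shows "measure_pmf.prob (cuts \<rho> (n - 1)) (long_block n k) \<le> real n * (1 - \<rho>) ^ k"
proof -
  have "measure_pmf.prob (cuts \<rho> (n - 1)) (long_block n k) \<le>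
    measure_pmf.prob (cuts \<rho> (n - 1)) (\<Union>a\<in>{a. a + k < n}. {d. \<forall>t\<in>{a..<a + k}. \<not> d t})"
    by (intro measure_pmf.finite_measure_mono) (auto simp: long_block_def)
  also have fin: "finite {a. a + k < n}" by (rule finite_subset[of _ "{..<n}"]) auto
  have "measure_pmf.prob (cuts \<rho> (n - 1)) (\<Union>a\<in>{a. a + k < n}. {d. \<forall>t\<in>{a..<a + k}. \<not> d t}) \<le>
    (\<Sum>a\<in>{a. a + k < n}. measure_pmf.prob (cuts \<rho> (n - 1)) {d. \<forall>t\<in>{a..<a + k}. \<not> d t})"
    using fin by (intro measure_pmf.finite_measure_subadditive_finite) auto
  also have "\<dots> = (\<Sum>a\<in>{a. a + k < n}. (1 - \<rho>) ^ k)"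
    using assms by (intro sum.cong prob_linked_interval) auto
  also have "\<dots> = real (card {a. a + k < n}) * (1 - \<rho>) ^ k" by simp
  also have "\<dots> \<le> real n * (1 - \<rho>) ^ k"
  proof (intro mult_right_mono)
    have "{a. a + k < n} \<subseteq> {..<n}" by auto
    then show "real (card {a. a + k < n}) \<le> real n" using card_mono[of "{..<n}"] by fastforce
  qed (use assms in simp)
  finally show ?thesis .
qed

text \<open>Outside \<open>long_block\<close>, linked vertices are less than \<open>k\<close> apart.
  For \<open>x < k\<close> the truncated difference \<open>x - k\<close> is \<open>0\<close>, and
  the window still covers everything up to \<open>x + k\<close>, exclusive.\<close>

lemma linked_mass_le:
  assumes "d \<notin> long_block n k" "k > 0" "x < n" "\<And>y. z y \<ge> (0::real)"
  shows "(\<Sum>y<n. z y * of_bool (linked d x y)) \<le> (\<Sum>y\<in>{x - k..<x - k + 2 * k}. z y)"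
proof -
  have near: "y \<in> {x - k..<x - k + 2 * k}" if "y < n" "linked d x y" for y
  proof (rule ccontr)
    assume *: "y \<notin> {x - k..<x - k + 2 * k}"
    have **: "min x y + k \<le> max x y"
      using * \<open>k > 0\<close> by (auto simp: min_def max_def split: if_splits)
    then have "min x y + k < n" using that assms(3) by auto
    moreover have "\<forall>t\<in>{min x y..<min x y + k}. \<not> d t"
      using that(2) ** unfolding linked_def by (meson atLeastLessThan_iff less_le_trans)
    ultimately show False using assms(1) by (auto simp: long_block_def)
  qed
  have "(\<Sum>y<n. z y * of_bool (linked d x y)) = (\<Sum>y\<in>{y. y < n \<and> linked d x y}. z y)"
    by (intro sum.mono_neutral_cong_right) auto
  also have "\<dots> \<le> (\<Sum>y\<in>{x - k..<x - k + 2 * k}. z y)"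
    using near assms(4) by (intro sum_mono2) auto
  finally show ?thesis .
qed

section \<open>Executions of the tester\<close>

lemma prob_bind_pmf_le:
  assumes "e \<ge> 0" "\<And>x. x \<in> set_pmf M \<Longrightarrow> x \<notin> B \<Longrightarrow> measure_pmf.prob (f x) A \<le> e"
  shows "measure_pmf.prob (bind_pmf M f) A \<le> measure_pmf.prob M B + e"
proof -
  have "ennreal (measure_pmf.prob (bind_pmf M f) A) = (\<integral>\<^sup>+x. emeasure (measure_pmf (f x)) A \<partial>measure_pmf M)"
    by (simp add: measure_pmf.emeasure_eq_measure[symmetric])
  also have "\<dots> \<le> (\<integral>\<^sup>+x. indicator B x + ennreal e \<partial>measure_pmf M)"
  proof (intro nn_integral_mono_AE, unfold AE_measure_pmf_iff, intro ballI)
    fix x assume "x \<in> set_pmf M"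
    then show "emeasure (measure_pmf (f x)) A \<le> indicator B x + ennreal e"
      using assms(2)[of x] measure_pmf.prob_le_1[of "f x" A]
      by (cases "x \<in> B") (auto simp: measure_pmf.emeasure_eq_measure intro: ennreal_leI add_increasing2)
  qed
  also have "\<dots> = emeasure (measure_pmf M) B + ennreal e"
    by (subst nn_integral_add) (auto simp: measure_pmf.emeasure_space_1[simplified])
  also have "\<dots> = ennreal (measure_pmf.prob M B + e)"
    using assms(1) by (simp add: measure_pmf.emeasure_eq_measure ennreal_plus)
  finally show ?thesis using assms(1) by (simp add: ennreal_plus[symmetric] del: ennreal_plus)
qed

lemma run_request_samples:
  "run \<mu> r (request_samples N k) = bind_pmf (replicate_pmf N (map_pmf r \<mu>))
     (\<lambda>vs. map_pmf (num_samples_update ((+) N)) (run \<mu> r (k vs)))"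
proof (induction N arbitrary: k)
  case 0
  have "map_pmf (num_samples_update ((+) 0)) q = q" for q :: "outcome pmf"
    using pmf.map_cong[of q q "num_samples_update ((+) 0)" "\<lambda>x. x"] by simp
  then show ?case unfolding request_samples.simps replicate_pmf.simps bind_return_pmf by simp
next
  case (Suc N)
  have "num_samples_update Suc \<circ> num_samples_update ((+) N) = (num_samples_update (\<lambda>a. Suc (N + a)) :: outcome \<Rightarrow> _)"
    by (simp add: fun_eq_iff)
  then show ?case
    by (simp add: Suc.IH bind_assoc_pmf bind_map_pmf bind_return_pmf map_bind_pmf pmf.map_comp)
qed

lemma run_tester:
  "run \<mu> r (tester \<alpha> \<beta> c n E \<epsilon> \<rho>) = bind_pmf (poisson_pmf (tester_rate c n \<epsilon> \<rho>)) (\<lambda>N.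
     map_pmf (\<lambda>vs. \<lparr>accepted = decision \<alpha> \<beta> c n E \<epsilon> \<rho> vs, num_samples = N, num_labels = 0\<rparr>)
       (replicate_pmf N (map_pmf r \<mu>)))"
  unfolding tester_def
  by (simp add: join_eq_bind_pmf bind_map_pmf run_request_samples map_pmf_def[symmetric] pmf.map_comp o_def)

lemma accepted_execution_tester:
  "map_pmf accepted (execution n E \<rho> \<mu> (tester \<alpha> \<beta> c n E \<epsilon> \<rho>)) =
     bind_pmf (random_clustering n E \<rho>) (\<lambda>r.
       map_pmf (decision \<alpha> \<beta> c n E \<epsilon> \<rho>) (poisson_sample (tester_rate c n \<epsilon> \<rho>) (map_pmf r \<mu>)))"
  unfolding execution_def run_tester poisson_sample_def
  by (simp add: map_bind_pmf pmf.map_comp o_def)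

lemma nn_integral_poisson_pmf_id:
  assumes "m > 0"
  shows "(\<integral>\<^sup>+N. of_nat N \<partial>measure_pmf (poisson_pmf m)) = ennreal m"
  using poisson_binomial_moment[OF assms, of 1]
  by (simp add: ennreal_of_nat_eq_real_of_nat nn_integral_eq_integral)

lemma sample_complexity_tester:
  assumes "n > 0" "tester_rate c n \<epsilon> \<rho> > 0"
  shows "sample_complexity n E \<rho> (tester \<alpha> \<beta> c n E \<epsilon> \<rho>) = ennreal (tester_rate c n \<epsilon> \<rho>)"
proof -
  have "(\<integral>\<^sup>+ \<omega>. of_nat (num_samples \<omega>) \<partial>measure_pmf (execution n E \<rho> \<mu> (tester \<alpha> \<beta> c n E \<epsilon> \<rho>)))
      = ennreal (tester_rate c n \<epsilon> \<rho>)" for \<mu>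
    unfolding execution_def run_tester
    by (simp add: nn_integral_poisson_pmf_id[OF assms(2)] measure_pmf.emeasure_space_1[simplified])
  \<comment> \<open>The supremum of a constant is that constant only over a nonempty set.\<close>
  moreover have "return_pmf 0 \<in> distributions n" using assms by (simp add: distributions_def)
  ultimately show ?thesis
    unfolding sample_complexity_def by (auto simp: SUP_constant)
qed

lemma no_label_queries_tester: "no_label_queries n E \<rho> (tester \<alpha> \<beta> c n E \<epsilon> \<rho>)"
  by (auto simp: no_label_queries_def execution_def run_tester)

lemma random_clustering_representative:
  assumes "E \<in> {path_edges n, cycle_edges n}" "H \<in> set_pmf (random_subgraph E \<rho>)"
    and r: "r \<in> set_pmf (map_pmf (\<lambda>r x. r (cell_of H x)) (Pi_pmf (cells n H) 0 pmf_of_set))" and "x < n"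
  shows "r x \<in> cell_of H x \<and> r x < n"
proof -
  have fin: "finite (cells n H)" by (simp add: cells_def)
  have sub: "cell_of H x \<subseteq> {..<n}"
    using linked_if_same_cell[OF random_subgraph_subset[OF assms(1,2)] \<open>x < n\<close>]
    by (fastforce simp: mem_cell_of_iff)
  have "finite (cell_of H x)" using finite_subset[OF sub] by simp
  moreover have "x \<in> cell_of H x" by (simp add: mem_cell_of_iff)
  ultimately have "set_pmf (pmf_of_set (cell_of H x)) = cell_of H x"
    using set_pmf_of_set[of "cell_of H x"] by blast
  moreover obtain r' where r': "r' \<in> PiE_dflt (cells n H) 0 (set_pmf \<circ> pmf_of_set)" "r = (\<lambda>x. r' (cell_of H x))"
    using r by (auto simp: set_Pi_pmf[OF fin])
  moreover have "cell_of H x \<in> cells n H" using \<open>x < n\<close> by (simp add: cells_def)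
  ultimately have "r x \<in> cell_of H x" by (auto simp: PiE_dflt_def)
  then show ?thesis using sub by auto
qed

text \<open>Separates the two layers of randomness: a bad set of cuts, charged by its probability,
  and the samples for any other fixed clustering. A representative map enters as a choice of one
  member per cell.\<close>

lemma prob_execution_tester_le:
  assumes E: "E \<in> {path_edges n, cycle_edges n}" and "e \<ge> 0"
    and *: "\<And>H r. H \<subseteq> cycle_edges n \<Longrightarrow> path_cuts n H \<notin> Bad \<Longrightarrow>
      (\<And>x. x < n \<Longrightarrow> r x \<in> cell_of H x \<and> r x < n) \<Longrightarrow>
      (\<And>x y. cell_of H x = cell_of H y \<Longrightarrow> r x = r y) \<Longrightarrow>
      measure_pmf.prob (poisson_sample (tester_rate c n \<epsilon> \<rho>) (map_pmf r \<mu>))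
        {vs. decision \<alpha> \<beta> c n E \<epsilon> \<rho> vs = b} \<le> e"
  shows "measure_pmf.prob (execution n E \<rho> \<mu> (tester \<alpha> \<beta> c n E \<epsilon> \<rho>)) {\<omega>. accepted \<omega> = b}
      \<le> measure_pmf.prob (cuts \<rho> (n - 1)) Bad + e"
proof -
  have "measure_pmf.prob (execution n E \<rho> \<mu> (tester \<alpha> \<beta> c n E \<epsilon> \<rho>)) {\<omega>. accepted \<omega> = b} =
    measure_pmf.prob (map_pmf accepted (execution n E \<rho> \<mu> (tester \<alpha> \<beta> c n E \<epsilon> \<rho>))) {b}"
    by (simp add: vimage_def)
  also have "\<dots> \<le> measure_pmf.prob (random_subgraph E \<rho>) (path_cuts n -` Bad) + e"
    unfolding accepted_execution_tester random_clustering_def bind_assoc_pmf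
  proof (rule prob_bind_pmf_le[OF \<open>e \<ge> 0\<close>])
    fix H assume H: "H \<in> set_pmf (random_subgraph E \<rho>)" "H \<notin> path_cuts n -` Bad"
    let ?R = "map_pmf (\<lambda>r x. r (cell_of H x)) (Pi_pmf (cells n H) 0 pmf_of_set)"
    have "measure_pmf.prob (bind_pmf ?R (\<lambda>r. map_pmf (decision \<alpha> \<beta> c n E \<epsilon> \<rho>)
        (poisson_sample (tester_rate c n \<epsilon> \<rho>) (map_pmf r \<mu>)))) {b} \<le> measure_pmf.prob ?R {} + e"
    proof (rule prob_bind_pmf_le[OF \<open>e \<ge> 0\<close>])
      fix r assume "r \<in> set_pmf ?R"
      note rep = random_clustering_representative[OF E H(1) this]
      have cong: "r x = r y" if "cell_of H x = cell_of H y" for x y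
        using \<open>r \<in> set_pmf ?R\<close> that by auto
      have cut: "path_cuts n H \<notin> Bad" using H(2) by simp
      have "measure_pmf.prob (poisson_sample (tester_rate c n \<epsilon> \<rho>) (map_pmf r \<mu>))
          {vs. decision \<alpha> \<beta> c n E \<epsilon> \<rho> vs = b} \<le> e"
        by (rule *[OF random_subgraph_subset[OF E H(1)] cut rep cong])
      then show "measure_pmf.prob (map_pmf (decision \<alpha> \<beta> c n E \<epsilon> \<rho>)
          (poisson_sample (tester_rate c n \<epsilon> \<rho>) (map_pmf r \<mu>))) {b} \<le> e"
        by (simp add: vimage_def)
    qed
    then show "measure_pmf.prob (bind_pmf ?R (\<lambda>r. map_pmf (decision \<alpha> \<beta> c n E \<epsilon> \<rho>)
        (poisson_sample (tester_rate c n \<epsilon> \<rho>) (map_pmf r \<mu>)))) {b} \<le> e" by simp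
  qed
  also have "measure_pmf.prob (random_subgraph E \<rho>) (path_cuts n -` Bad) = measure_pmf.prob (cuts \<rho> (n - 1)) Bad"
    unfolding path_cuts_random_subgraph[OF E, symmetric] by simp
  finally show ?thesis .
qed

section \<open>Distribution of the returned representatives\<close>

lemma pmf_map_finite:
  fixes \<mu> :: "nat pmf"
  assumes "set_pmf \<mu> \<subseteq> {..<n}"
  shows "pmf (map_pmf r \<mu>) v = (\<Sum>x<n. pmf \<mu> x * of_bool (r x = v))"
proof -
  have "pmf (map_pmf r \<mu>) v = measure_pmf.prob \<mu> (r -` {v} \<inter> {..<n})"
    unfolding pmf_map
  proof (intro measure_prob_cong_0)
    fix x assume "x \<in> r -` {v} - (r -` {v} \<inter> {..<n})"
    then have "x \<notin> set_pmf \<mu>" using assms by blast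
    then show "pmf \<mu> x = 0" by (simp add: set_pmf_iff)
  qed blast
  also have "\<dots> = (\<Sum>x\<in>r -` {v} \<inter> {..<n}. pmf \<mu> x)" by (simp add: measure_measure_pmf_finite)
  also have "\<dots> = (\<Sum>x<n. pmf \<mu> x * of_bool (r x = v))" by (intro sum.mono_neutral_cong_left) auto
  finally show ?thesis .
qed

context
  fixes n :: nat and H :: "nat set set" and r :: "nat \<Rightarrow> nat" and \<mu> :: "nat pmf"
  assumes r: "\<And>x. x < n \<Longrightarrow> r x \<in> cell_of H x \<and> r x < n"
    and cong: "\<And>x y. cell_of H x = cell_of H y \<Longrightarrow> r x = r y"
    and \<mu>: "set_pmf \<mu> \<subseteq> {..<n}"
begin

lemma representative_eq_iff:
  assumes "x < n" "y < n"
  shows "r x = r y \<longleftrightarrow> cell_of H x = cell_of H y"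
  using r[OF assms(1)] r[OF assms(2)] cong[of x y] by (auto simp: mem_cell_of_iff)

lemma finite_set_representatives: "finite (set_pmf (map_pmf r \<mu>))"
  using \<mu> by (auto intro: finite_subset)

text \<open>Distinct cells have distinct representatives, so a returned value carries the mass of
  exactly one cell.\<close>

lemma collision_energy: "(\<Sum>v<n. (pmf (map_pmf r \<mu>) v)\<^sup>2) = energy n (pmf \<mu>) H"
proof -
  have "(\<Sum>v<n. (pmf (map_pmf r \<mu>) v)\<^sup>2) =
      (\<Sum>v<n. \<Sum>x<n. \<Sum>y<n. pmf \<mu> x * pmf \<mu> y * (of_bool (r x = v) * of_bool (r y = v)))"
    by (simp only: pmf_map_finite[OF \<mu>] power2_eq_square sum_product mult_ac)
  also have "\<dots> = (\<Sum>x<n. \<Sum>v<n. \<Sum>y<n. pmf \<mu> x * pmf \<mu> y * (of_bool (r x = v) * of_bool (r y = v)))"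
    by (rule sum.swap)
  also have "\<dots> = (\<Sum>x<n. \<Sum>y<n. \<Sum>v<n. pmf \<mu> x * pmf \<mu> y * (of_bool (r x = v) * of_bool (r y = v)))"
    by (intro sum.cong refl sum.swap)
  also have "\<dots> = energy n (pmf \<mu>) H"
    unfolding energy_def
  proof (intro sum.cong refl)
    fix x y assume "x \<in> {..<n}" "y \<in> {..<n}"
    then have xy: "x < n" "y < n" by auto
    have "(\<Sum>v<n. pmf \<mu> x * pmf \<mu> y * (of_bool (r x = v) * of_bool (r y = v))) =
        (\<Sum>v<n. if v = r x then pmf \<mu> x * pmf \<mu> y * of_bool (r y = r x) else 0)"
      by (intro sum.cong) auto
    also have "\<dots> = pmf \<mu> x * pmf \<mu> y * of_bool (cell_of H x = cell_of H y)"
      using r[OF xy(1)] representative_eq_iff[OF xy] by (auto simp: sum.delta)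
    finally show "(\<Sum>v<n. pmf \<mu> x * pmf \<mu> y * (of_bool (r x = v) * of_bool (r y = v))) =
        pmf \<mu> x * pmf \<mu> y * of_bool (cell_of H x = cell_of H y)" .
  qed
  finally show ?thesis .
qed

lemma pmf_representative:
  assumes "x < n"
  shows "pmf (map_pmf r \<mu>) (r x) = (\<Sum>y<n. pmf \<mu> y * of_bool (cell_of H x = cell_of H y))"
  unfolding pmf_map_finite[OF \<mu>] using representative_eq_iff[OF _ assms]
  by (intro sum.cong refl) auto

lemma pmf_representatives_le:
  assumes "\<And>x. x < n \<Longrightarrow> (\<Sum>y<n. pmf \<mu> y * of_bool (cell_of H x = cell_of H y)) \<le> B" "B \<ge> 0"
  shows "pmf (map_pmf r \<mu>) v \<le> B"
proof (cases "\<exists>x<n. r x = v")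
  case True
  then show ?thesis using pmf_representative assms(1) by auto
next
  case False
  then have "pmf (map_pmf r \<mu>) v = 0" unfolding pmf_map_finite[OF \<mu>] by (intro sum.neutral) auto
  then show ?thesis using assms(2) by simp
qed

end


section \<open>Error probabilities for a fixed clustering\<close>

lemma decision_iff:
  assumes "n > 0"
  shows "decision \<alpha> \<beta> c n E \<epsilon> \<rho> vs \<longleftrightarrow>
    (\<forall>v<n. real (count_list vs v) < \<alpha> * ln n) \<and>
    1 / (tester_rate c n \<epsilon> \<rho>)\<^sup>2 * (\<Sum>v<n. real (count_list vs v) * (real (count_list vs v) - 1)) <
      1 / (real n)\<^sup>2 * (\<Sum>i<n. \<Sum>j<n. same_cell_prob E \<rho> i j) + \<beta> * (1 / n) * \<epsilon>\<^sup>2 * \<rho>"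
proof -
  have "(MAX v\<in>{..<n}. real (count_list vs v)) \<ge> \<alpha> * ln n \<longleftrightarrow> (\<exists>v<n. real (count_list vs v) \<ge> \<alpha> * ln n)"
    using assms by (subst Max_ge_iff) auto
  then show ?thesis by (auto simp: decision_def Let_def not_le)
qed

context
  fixes \<alpha> \<beta> c \<epsilon> \<rho> thr m :: real and n :: nat and E :: "nat set set" and p :: "nat pmf"
  assumes n: "n > 0" and fin: "finite (set_pmf p)" and m0: "tester_rate c n \<epsilon> \<rho> > 0"
  defines "m \<equiv> tester_rate c n \<epsilon> \<rho>"
    and "thr \<equiv> 1 / (real n)\<^sup>2 * (\<Sum>i<n. \<Sum>j<n. same_cell_prob E \<rho> i j) + \<beta> * (1 / n) * \<epsilon>\<^sup>2 * \<rho>"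
begin

lemma reject_prob_le:
  assumes A: "\<And>v. pmf p v \<le> A" and t: "t > 0" "(\<Sum>v<n. (pmf p v)\<^sup>2) + t \<le> thr"
  shows "measure_pmf.prob (poisson_sample m p) {vs. decision \<alpha> \<beta> c n E \<epsilon> \<rho> vs = False} \<le>
    real n * exp (2 * (m * A) - \<alpha> * ln n) + (4 * A / m + 2 / m\<^sup>2) * (\<Sum>v<n. (pmf p v)\<^sup>2) / t\<^sup>2"
proof -
  let ?P = "measure_pmf.prob (poisson_sample m p)"
  have m: "m > 0" using m0 by (simp add: m_def)
  let ?Y = "\<lambda>vs. 1 / m\<^sup>2 * (\<Sum>v<n. real (count_list vs v) * (real (count_list vs v) - 1))"
  let ?S = "\<Sum>v<n. (pmf p v)\<^sup>2"
  have "?P {vs. decision \<alpha> \<beta> c n E \<epsilon> \<rho> vs = False} \<le>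
      ?P ((\<Union>v<n. {vs. real (count_list vs v) \<ge> \<alpha> * ln n}) \<union> {vs. \<bar>?Y vs - ?S\<bar> \<ge> t})"
  proof (intro measure_pmf.finite_measure_mono subsetI)
    fix vs assume "vs \<in> {vs. decision \<alpha> \<beta> c n E \<epsilon> \<rho> vs = False}"
    then have "(\<exists>v<n. real (count_list vs v) \<ge> \<alpha> * ln n) \<or> ?Y vs \<ge> thr"
      by (auto simp: decision_iff[OF n] m_def thr_def not_less)
    then show "vs \<in> (\<Union>v<n. {vs. real (count_list vs v) \<ge> \<alpha> * ln n}) \<union> {vs. \<bar>?Y vs - ?S\<bar> \<ge> t}"
    proof
      assume "?Y vs \<ge> thr"
      then have "\<bar>?Y vs - ?S\<bar> \<ge> t" using t by linarith
      then show ?thesis by blast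
    qed auto
  qed auto
  also have "\<dots> \<le> ?P (\<Union>v<n. {vs. real (count_list vs v) \<ge> \<alpha> * ln n}) + ?P {vs. \<bar>?Y vs - ?S\<bar> \<ge> t}"
    by (rule measure_Un_le) auto
  also have "?P {vs. \<bar>?Y vs - ?S\<bar> \<ge> t} \<le> (4 * A / m + 2 / m\<^sup>2) * ?S / t\<^sup>2"
    using poisson_sample_collision_chebyshev[OF fin m finite_lessThan A t(1), of n] .
  also have "?P (\<Union>v<n. {vs. real (count_list vs v) \<ge> \<alpha> * ln n}) \<le>
      (\<Sum>v<n. ?P {vs. real (count_list vs v) \<ge> \<alpha> * ln n})"
    by (intro measure_pmf.finite_measure_subadditive_finite) auto
  also have "\<dots> \<le> (\<Sum>v<n. exp (2 * (m * A) - \<alpha> * ln n))"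
  proof (intro sum_mono)
    fix v
    have "m * pmf p v \<le> m * A" using m A by simp
    then show "?P {vs. real (count_list vs v) \<ge> \<alpha> * ln n} \<le> exp (2 * (m * A) - \<alpha> * ln n)"
      by (intro order_trans[OF poisson_sample_upper_tail[OF fin m]]) simp
  qed
  finally show ?thesis by simp
qed

text \<open>With \<open>S\<close> the collision sum, the excess \<open>S - thr\<close> may be far
  larger than \<open>t\<close>, so Chebyshev is applied at distance \<open>S - thr\<close>. The
  variance grows with \<open>S\<close>, but \<open>S / (S - thr)\<^sup>2 = 1 / (S - thr) + thr / (S
  - thr)\<^sup>2\<close> decreases in the excess.\<close>

lemma accept_prob_le:
  assumes A: "\<And>v. pmf p v \<le> A" "A \<ge> 0" and t: "t > 0" "thr + t \<le> (\<Sum>v<n. (pmf p v)\<^sup>2)" and thr: "thr \<ge> 0"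
  shows "measure_pmf.prob (poisson_sample m p) {vs. decision \<alpha> \<beta> c n E \<epsilon> \<rho> vs = True} \<le>
    (4 * A / m + 2 / m\<^sup>2) * (1 / t + thr / t\<^sup>2)"
proof -
  let ?P = "measure_pmf.prob (poisson_sample m p)"
  have m: "m > 0" using m0 by (simp add: m_def)
  let ?Y = "\<lambda>vs. 1 / m\<^sup>2 * (\<Sum>v<n. real (count_list vs v) * (real (count_list vs v) - 1))"
  define S where "S = (\<Sum>v<n. (pmf p v)\<^sup>2)"
  have tS: "t \<le> S - thr" using t(2) by (simp add: S_def)
  have "?P {vs. decision \<alpha> \<beta> c n E \<epsilon> \<rho> vs = True} \<le> ?P {vs. \<bar>?Y vs - S\<bar> \<ge> S - thr}"
  proof (intro measure_pmf.finite_measure_mono subsetI)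
    fix vs assume "vs \<in> {vs. decision \<alpha> \<beta> c n E \<epsilon> \<rho> vs = True}"
    then have "?Y vs < thr" by (auto simp: decision_iff[OF n] m_def thr_def)
    then have "\<bar>?Y vs - S\<bar> \<ge> S - thr" by linarith
    then show "vs \<in> {vs. \<bar>?Y vs - S\<bar> \<ge> S - thr}" by blast
  qed auto
  also have "\<dots> \<le> (4 * A / m + 2 / m\<^sup>2) * S / (S - thr)\<^sup>2"
    using poisson_sample_collision_chebyshev[OF fin m finite_lessThan A(1), of "S - thr" n] t tS
    by (simp add: S_def)
  also have "\<dots> = (4 * A / m + 2 / m\<^sup>2) * (1 / (S - thr) + thr / (S - thr)\<^sup>2)"
  proof -
    define u where "u = S - thr"
    have "u > 0" "S = thr + u" using t tS by (auto simp: u_def)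
    then show ?thesis unfolding u_def[symmetric] by (simp add: field_simps power2_eq_square)
  qed
  also have "\<dots> \<le> (4 * A / m + 2 / m\<^sup>2) * (1 / t + thr / t\<^sup>2)"
    using t tS m A(2) thr
    by (intro mult_left_mono add_mono divide_left_mono power_mono mult_pos_pos) auto
  finally show ?thesis .
qed

text \<open>At mean at least \<open>4 * \<alpha> * ln n\<close>, half of the mean in the lower tail
  pays for the cut-off \<open>\<alpha> * ln n\<close> twice.\<close>

lemma accept_prob_heavy_le:
  assumes "v < n" "4 * \<alpha> * ln n \<le> m * pmf p v"
  shows "measure_pmf.prob (poisson_sample m p) {vs. decision \<alpha> \<beta> c n E \<epsilon> \<rho> vs = True} \<le> exp (- \<alpha> * ln n)"
proof -
  have m: "m > 0" using m0 by (simp add: m_def)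
  have "measure_pmf.prob (poisson_sample m p) {vs. decision \<alpha> \<beta> c n E \<epsilon> \<rho> vs = True} \<le>
      measure_pmf.prob (poisson_sample m p) {vs. real (count_list vs v) \<le> \<alpha> * ln n}"
    using assms(1) by (intro measure_pmf.finite_measure_mono) (auto simp: decision_iff[OF n] intro: less_imp_le)
  also have "\<dots> \<le> exp (\<alpha> * ln n - m * pmf p v / 2)"
    by (rule poisson_sample_lower_tail[OF fin m])
  also have "\<dots> \<le> exp (- \<alpha> * ln n)" using assms(2) by simp
  finally show ?thesis .
qed

end

section \<open>Light distributions\<close>

definition light :: "real \<Rightarrow> nat \<Rightarrow> (nat \<Rightarrow> real) \<Rightarrow> bool" where
  "light M w z \<longleftrightarrow> (\<forall>a. (\<Sum>y\<in>{a..a + w}. z y) \<le> M)"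

text \<open>Cover the interval by consecutive windows of \<open>w + 1\<close> vertices; the
  \<open>+ 1\<close> in the factor pays for the last, incomplete one.\<close>

lemma light_interval:
  fixes z :: "nat \<Rightarrow> real"
  assumes "light M w z" "M \<ge> 0" "\<And>y. z y \<ge> 0"
  shows "(\<Sum>y\<in>{a..<a + j}. z y) \<le> (real j / real (w + 1) + 1) * M"
proof (induction j arbitrary: a rule: less_induct)
  case (less j)
  have le: "(\<Sum>y\<in>{a..a + w}. z y) \<le> M" using assms(1) by (simp add: light_def)
  show ?case
  proof (cases "j \<le> w + 1")
    case True
    have "(\<Sum>y\<in>{a..<a + j}. z y) \<le> (\<Sum>y\<in>{a..a + w}. z y)"
      using True assms(3) by (intro sum_mono2) auto
    also have "\<dots> \<le> (0 + 1) * M" using le by simp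
    also have "\<dots> \<le> (real j / real (w + 1) + 1) * M"
      using assms(2) by (intro mult_right_mono add_right_mono) auto
    finally show ?thesis .
  next
    case False
    define i where "i = j - (w + 1)"
    have ij: "i < j" "j = i + (w + 1)" using False by (auto simp: i_def)
    have "{a..<a + j} = {a..a + w} \<union> {a + w + 1..<a + w + 1 + i}" using ij by auto
    then have "(\<Sum>y\<in>{a..<a + j}. z y) = (\<Sum>y\<in>{a..a + w}. z y) + (\<Sum>y\<in>{a + w + 1..<a + w + 1 + i}. z y)"
      by (simp only:) (rule sum.union_disjoint; auto)
    also have "\<dots> \<le> M + (real i / real (w + 1) + 1) * M"
      using le less[OF ij(1), of "a + w + 1"] by linarith
    also have "\<dots> = (real j / real (w + 1) + 1) * M"
      by (simp add: ij(2) field_simps)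
    finally show ?thesis .
  qed
qed

text \<open>The function \<open>R\<close> of the martingale: \<open>(1 - \<rho>) ^ i\<close> is the
  probability that the \<open>i\<close> edges to the right of \<open>j\<close> survive. Stopping
  after \<open>n\<close> terms loses nothing for masses that vanish from \<open>n\<close>
  on.\<close>

definition right_mass :: "real \<Rightarrow> nat \<Rightarrow> (nat \<Rightarrow> real) \<Rightarrow> nat \<Rightarrow> real" where
  "right_mass \<rho> n z j = (\<Sum>i<n. (1 - \<rho>) ^ i * z (j + i))"

lemma right_mass_rec:
  assumes "\<And>y. y \<ge> n \<Longrightarrow> z y = 0"
  shows "right_mass \<rho> n z j = z j + (1 - \<rho>) * right_mass \<rho> n z (Suc j)"
proof -
  have "right_mass \<rho> n z j = (\<Sum>i<Suc n. (1 - \<rho>) ^ i * z (j + i))"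
    using assms by (simp add: right_mass_def)
  also have "\<dots> = z j + (\<Sum>i<n. (1 - \<rho>) ^ Suc i * z (j + Suc i))"
    by (subst sum.lessThan_Suc_shift) simp
  finally show ?thesis by (simp add: right_mass_def sum_distrib_left mult.assoc)
qed

lemma right_mass_shift:
  assumes "\<And>y. y \<ge> n \<Longrightarrow> z y = 0"
  shows "right_mass \<rho> n z j = (\<Sum>i<t. (1 - \<rho>) ^ i * z (j + i)) + (1 - \<rho>) ^ t * right_mass \<rho> n z (j + t)"
proof (induction t)
  case (Suc t)
  have "(1 - \<rho>) ^ t * right_mass \<rho> n z (j + t) =
      (1 - \<rho>) ^ t * (z (j + t) + (1 - \<rho>) * right_mass \<rho> n z (Suc (j + t)))"
    using right_mass_rec[of n z \<rho> "j + t", OF assms] by (simp only:)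
  then show ?case
    using Suc by (simp only: distrib_left sum.lessThan_Suc power_Suc add_Suc_right mult_ac add_ac)
qed simp

text \<open>Every window contributes at most \<open>M\<close>, and passing to the next one costs a
  factor at most \<open>10/11\<close>; the geometric series sums to \<open>11 * M\<close>.\<close>

lemma right_mass_bounds:
  assumes z: "\<And>y. y \<ge> n \<Longrightarrow> z y = 0" "\<And>y. z y \<ge> 0" and light: "light M w z" and "M \<ge> 0"
    and \<rho>: "0 \<le> \<rho>" "\<rho> \<le> 1" "(1 - \<rho>) ^ (w + 1) \<le> 10 / 11"
  shows "0 \<le> right_mass \<rho> n z j" "right_mass \<rho> n z j \<le> 11 * M"
proof -
  show "0 \<le> right_mass \<rho> n z j"
    using \<rho> z(2) unfolding right_mass_def by (intro sum_nonneg mult_nonneg_nonneg) auto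
  show "right_mass \<rho> n z j \<le> 11 * M"
  proof (induction "n - j" arbitrary: j rule: less_induct)
    case less
    show ?case
    proof (cases "j \<ge> n")
      case True
      then have "right_mass \<rho> n z j = 0" using z(1) by (simp add: right_mass_def)
      then show ?thesis using \<open>M \<ge> 0\<close> by simp
    next
      case False
      have "(\<Sum>i<w + 1. (1 - \<rho>) ^ i * z (j + i)) \<le> (\<Sum>i<w + 1. 1 * z (j + i))"
        using \<rho> z(2) by (intro sum_mono mult_right_mono) (auto intro: power_le_one)
      also have "\<dots> = (\<Sum>y\<in>{j..j + w}. z y)"
        by (rule sum.reindex_bij_witness[of _ "\<lambda>y. y - j" "\<lambda>i. j + i"]) auto
      also have "\<dots> \<le> M" using light by (simp add: light_def)
      finally have 1: "(\<Sum>i<w + 1. (1 - \<rho>) ^ i * z (j + i)) \<le> M" .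
      have "right_mass \<rho> n z (j + (w + 1)) \<le> 11 * M" using False by (intro less) auto
      then have "(1 - \<rho>) ^ (w + 1) * right_mass \<rho> n z (j + (w + 1)) \<le> (10 / 11) * (11 * M)"
        using \<rho> \<open>M \<ge> 0\<close> by (intro mult_mono') (auto simp: right_mass_def intro!: sum_nonneg mult_nonneg_nonneg z(2))
      then show ?thesis using 1 right_mass_shift[where n = n and \<rho> = \<rho> and j = j and t = "w + 1", OF z(1)] by simp
    qed
  qed
qed

lemma pmf_uniform: "x < n \<Longrightarrow> pmf (pmf_of_set {..<n}) x = 1 / real n" for n :: nat
  by (subst pmf_of_set) (auto simp: lessThan_empty_iff)

lemma energy_uniform: "energy n (pmf (pmf_of_set {..<n})) H = energy n (\<lambda>_. 1 / n) H"
  unfolding energy_def by (intro sum.cong refl) (simp add: pmf_uniform)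

lemma block_sum_cong: "(\<And>x. x \<le> i \<Longrightarrow> z x = z' x) \<Longrightarrow> block_sum z d i = block_sum z' d i"
  by (induction i) auto

lemma block_energy_cong: "(\<And>x. x \<le> i \<Longrightarrow> z x = z' x) \<Longrightarrow> block_energy z d i = block_energy z' d i"
  using block_sum_cong by (simp add: block_energy_eq)

lemma mean_energy_cong: "(\<And>x. x \<le> i \<Longrightarrow> z x = z' x) \<Longrightarrow> mean_energy z \<rho> i = mean_energy z' \<rho> i"
  unfolding mean_energy_def using block_energy_cong[of i z z'] by simp

lemma energy_le_one:
  assumes "set_pmf \<mu> \<subseteq> {..<n}"
  shows "energy n (pmf \<mu>) H \<le> 1"
proof -
  have "energy n (pmf \<mu>) H \<le> (\<Sum>x<n. \<Sum>y<n. pmf \<mu> x * pmf \<mu> y * 1)"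
    unfolding energy_def by (intro sum_mono mult_left_mono) auto
  also have "\<dots> = (\<Sum>x<n. pmf \<mu> x) * (\<Sum>y<n. pmf \<mu> y)" by (simp add: sum_product)
  also have "(\<Sum>x<n. pmf \<mu> x) = 1" using assms by (intro sum_pmf_eq_1) auto
  finally show ?thesis by simp
qed

section \<open>Analysis of the tester\<close>

text \<open>
  The energy gap of a far distribution is of order \<open>g\<close>, and \<open>h\<close> bounds \<open>M\<^sup>2\<close> and the factor
  \<open>4 A / m + 2 / m\<^sup>2\<close> up to constants.  The logarithms in the rate make \<open>h\<close> times the
  uniform energy \<open>O(\<eta> g\<^sup>2)\<close>, so that every Chebyshev bound is \<open>O(\<eta>)\<close> with \<open>\<eta> \<longlongrightarrow> 0\<close>.
  Under the uniform distribution the counts have mean at most \<open>20 l\<close>, and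
  \<open>exp (2 \<cdot> 20 l - 42 l) = 1 / n\<^sup>2\<close> accounts for \<open>\<alpha> = 42\<close>; further, \<open>168 = 4 \<cdot> 42\<close>.
\<close>

context
  fixes n k w :: nat and \<epsilon> \<rho> l m g h \<eta> M :: real
  assumes l: "l = ln n" "10 ^ 7 \<le> l" and \<epsilon>: "0 < \<epsilon>" "\<epsilon> \<le> 1" and \<rho>: "0 < \<rho>" "\<rho> \<le> 1"
    and key: "l ^ 4 \<le> n * \<epsilon> ^ 4 * \<rho> ^ 5"
    and m: "m = tester_rate 1 n \<epsilon> \<rho>"
    and w: "w = nat \<lfloor>1 / (10 * \<rho>)\<rfloor>" and k: "k = nat \<lceil>4 * l / \<rho>\<rceil>"
    and g: "g = \<epsilon>\<^sup>2 * \<rho> / n" and \<eta>: "\<eta> = 1 / l\<^sup>2" and h: "h = l\<^sup>2 / m\<^sup>2"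
    and M: "M = 168 * l / m"
begin

section \<open>Arithmetic of the parameters\<close>

lemma n_gt_1: "n > 1"
proof (rule ccontr)
  assume "\<not> n > 1"
  then have "n = 0 \<or> n = 1" by auto
  then show False using l by auto
qed

lemma l_le_n: "l \<le> n"
  using l n_gt_1 by (simp add: ln_bound)

lemma l_pos: "l \<ge> 1" "l > 0" using l(2) by simp_all

lemma g_pos: "g > 0" using g \<epsilon> \<rho> n_gt_1 by simp

text \<open>The requirement \<open>10 ^ 7 \<le> l\<close> makes \<open>\<eta>\<close> beat the
  largest constant of the Chebyshev bounds,
  \<open>20000000 * 4 * 4096 < 4 * 10 ^ 11\<close>.\<close>

lemma \<eta>_bounds: "0 < \<eta>" "\<eta> \<le> 1 / 10 ^ 14"
proof -
  show "0 < \<eta>" using \<eta> l_pos by simp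
  have "(10 ^ 7)\<^sup>2 \<le> l\<^sup>2" using l(2) by (intro power_mono) auto
  then have "1 / l\<^sup>2 \<le> 1 / (10 ^ 7)\<^sup>2" using l_pos by (intro divide_left_mono) auto
  then show "\<eta> \<le> 1 / 10 ^ 14" by (simp add: \<eta>)
qed

text \<open>The strictest demand is \<open>200 * (g * \<eta>) \<le> g / 64\<close>, in the uniform
  case.\<close>

lemma g_\<eta>_small: "20000 * (g * \<eta>) \<le> g"
  using mult_left_mono[OF \<eta>_bounds(2), of g] g_pos by simp

lemma m_pos: "m > 0"
  using m \<epsilon> \<rho> n_gt_1 l l_pos by (simp add: tester_rate_def)

lemma m_square: "m\<^sup>2 = n * l ^ 4 / (\<epsilon> ^ 4 * \<rho> ^ 3)"
proof -
  have "(\<rho> powr (3/2))\<^sup>2 = \<rho> ^ 3"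
    using \<rho> by (simp add: powr_power)
  then show ?thesis
    by (simp add: m tester_rate_def l(1) power_mult_distrib power_divide flip: power_mult)
qed

text \<open>Squared, this is \<open>key\<close> itself: under the uniform distribution,
  \<open>1 / \<rho>\<close> vertices expect at most one sample.\<close>

lemma m_le: "m \<le> \<rho> * n"
proof (rule power2_le_imp_le)
  have "real n * l ^ 4 \<le> real n * (n * \<epsilon> ^ 4 * \<rho> ^ 5)" using key by (intro mult_left_mono) auto
  also have "\<dots> = (\<rho> * n)\<^sup>2 * (\<epsilon> ^ 4 * \<rho> ^ 3)" by (simp add: power2_eq_square eval_nat_numeral)
  finally show "m\<^sup>2 \<le> (\<rho> * n)\<^sup>2"
    unfolding m_square using \<epsilon> \<rho> by (simp add: divide_le_eq)
qed (use \<rho> in simp)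

lemma key2: "l ^ 4 \<le> n * \<epsilon>\<^sup>2 * \<rho> ^ 3"
proof -
  have "\<epsilon> ^ 4 \<le> \<epsilon>\<^sup>2" "\<rho> ^ 5 \<le> \<rho> ^ 3" using \<epsilon> \<rho> by (auto intro: power_decreasing)
  then have "n * \<epsilon> ^ 4 * \<rho> ^ 5 \<le> n * \<epsilon>\<^sup>2 * \<rho> ^ 3" using \<epsilon> \<rho> by (intro mult_mono) auto
  then show ?thesis using key by simp
qed

lemma one_le_n_\<rho>: "1 \<le> n * \<rho>"
proof -
  have "1 \<le> l ^ 4" using l_pos by simp
  also have "\<dots> \<le> n * \<epsilon>\<^sup>2 * \<rho> ^ 3" by (rule key2)
  also have "\<dots> \<le> n * 1 * \<rho>" using \<epsilon> \<rho> power_decreasing[of 1 3 \<rho>]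
    by (intro mult_mono) (auto simp: power_le_one mult_left_le)
  finally show ?thesis by simp
qed

lemma h_eq: "h = \<epsilon> ^ 4 * \<rho> ^ 3 / (n * l\<^sup>2)"
  unfolding h m_square using l_pos n_gt_1 \<epsilon> \<rho> by (simp add: field_simps eval_nat_numeral)

lemma h_pos: "h > 0" using h m_pos l_pos by simp

lemma h_le: "h \<le> g * \<eta>"
proof -
  have "\<epsilon> ^ 4 * \<rho> ^ 3 \<le> \<epsilon>\<^sup>2 * \<rho> ^ 1" using \<epsilon> \<rho> by (intro mult_mono power_decreasing) auto
  then show ?thesis
    unfolding h_eq g \<eta> using l_pos n_gt_1 by (simp add: divide_right_mono)
qed

text \<open>Read backwards, this balance determines the rate: solved for \<open>m\<close> it gives
  the powers of \<open>n\<close>, \<open>\<epsilon>\<close>, \<open>\<rho>\<close> and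
  \<open>l\<close> in \<open>m_square\<close>.\<close>

lemma h_over_n_\<rho>: "h * (1 / (n * \<rho>)) = g\<^sup>2 * \<eta>"
  unfolding h_eq g \<eta> using l_pos n_gt_1 \<epsilon> \<rho> by (simp add: field_simps eval_nat_numeral)

text \<open>A block of \<open>O(l / \<rho>)\<close> vertices has uniform mass
  \<open>O(l / (n * \<rho>))\<close>, and closing the cycle costs the square of that; this makes the
  cost negligible against the gap.\<close>

lemma l2_le: "l\<^sup>2 / (n * \<rho>)\<^sup>2 \<le> g * \<eta>"
proof -
  have "l\<^sup>2 * (n * l\<^sup>2) = n * l ^ 4" by (simp add: eval_nat_numeral)
  also have "\<dots> \<le> n * (n * \<epsilon>\<^sup>2 * \<rho> ^ 3)" using key2 by (intro mult_left_mono) auto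
  also have "\<dots> = \<epsilon>\<^sup>2 * \<rho> * (n * \<rho>)\<^sup>2" by (simp add: eval_nat_numeral)
  finally have "l\<^sup>2 / (n * \<rho>)\<^sup>2 \<le> (\<epsilon>\<^sup>2 * \<rho>) / (n * l\<^sup>2)"
    using l_pos n_gt_1 \<rho> by (simp add: frac_le_eq pos_divide_le_eq field_simps)
  then show ?thesis unfolding g \<eta> by simp
qed

lemma one_le_l2: "1 / (n * \<rho>)\<^sup>2 \<le> g * \<eta>"
proof -
  have "1 / (n * \<rho>)\<^sup>2 \<le> l\<^sup>2 / (n * \<rho>)\<^sup>2" using l_pos by (intro divide_right_mono) auto
  then show ?thesis using l2_le by simp
qed

lemma n3_le: "1 / real n ^ 3 \<le> g * \<eta>"
proof -
  have "(n * \<rho>)\<^sup>2 \<le> real n ^ 2 * 1" unfolding power_mult_distrib using \<rho> by (intro mult_left_mono) (auto simp: power_le_one)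
  also have "\<dots> \<le> real n ^ 3" using n_gt_1 power_increasing[of 2 3 "real n"] by simp
  finally have "1 / real n ^ 3 \<le> 1 / (n * \<rho>)\<^sup>2" using n_gt_1 \<rho> by (intro divide_left_mono) auto
  then show ?thesis using one_le_l2 by simp
qed

lemma k_bounds: "4 * l / \<rho> \<le> k" "k \<le> 5 * l / \<rho>" "k > 0"
proof -
  have p: "4 * l / \<rho> > 0" using l_pos \<rho> by simp
  then show *: "4 * l / \<rho> \<le> k" unfolding k by (simp add: real_nat_ceiling_ge)
  show "k > 0" using p * by (cases k) auto
  have "real k \<le> 4 * l / \<rho> + 1" using p unfolding k by linarith
  also have "1 \<le> l / \<rho>" using l_pos \<rho> by (simp add: le_divide_eq)
  finally show "k \<le> 5 * l / \<rho>" by simp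
qed

lemma w_bounds: "1 \<le> 10 * \<rho> * (w + 1)" "\<rho> * w \<le> 1 / 10"
proof -
  have p: "1 / (10 * \<rho>) > 0" using \<rho> by simp
  have "1 / (10 * \<rho>) \<le> w + 1" unfolding w using p by linarith
  then show "1 \<le> 10 * \<rho> * (w + 1)" using \<rho> by (simp add: divide_le_eq mult_ac)
  have "w \<le> 1 / (10 * \<rho>)" unfolding w using p by linarith
  then show "\<rho> * w \<le> 1 / 10" using \<rho> by (simp add: le_divide_eq mult_ac)
qed

lemma power_w_le: "(1 - \<rho>) ^ (w + 1) \<le> 10 / 11"
proof -
  have "1 - \<rho> \<le> exp (- \<rho>)" using exp_ge_add_one_self[of "- \<rho>"] by simp
  then have "(1 - \<rho>) ^ (w + 1) \<le> exp (- \<rho>) ^ (w + 1)" using \<rho> by (intro power_mono) auto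
  also have "\<dots> = exp (- (\<rho> * (w + 1)))"
    by (subst exp_of_nat_mult[symmetric]) (simp add: algebra_simps)
  also have "\<dots> \<le> exp (- (1 / 10))" using w_bounds(1) by simp
  \<comment> \<open>From \<open>exp (1/10) \<ge> 11/10\<close>.\<close>
  also have "\<dots> \<le> 10 / 11"
    using exp_ge_add_one_self[of "1 / 10 :: real"] by (simp add: exp_minus field_simps)
  finally show ?thesis .
qed

lemma pmf_zero: "set_pmf \<mu> \<subseteq> {..<n} \<Longrightarrow> y \<ge> n \<Longrightarrow> pmf \<mu> y = 0"
  by (auto simp: set_pmf_iff)

text \<open>The \<open>4\<close> in \<open>k\<close> gives each run of \<open>k\<close> intact edges
  probability at most \<open>1 / n ^ 4\<close>; the choice of the starting point costs a factor
  \<open>n\<close>.\<close>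

lemma prob_long: "measure_pmf.prob (cuts \<rho> (n - 1)) (long_block n k) \<le> 1 / real n ^ 3"
proof -
  have "measure_pmf.prob (cuts \<rho> (n - 1)) (long_block n k) \<le> n * (1 - \<rho>) ^ k"
    using \<rho> by (intro prob_long_block) auto
  also have "(1 - \<rho>) ^ k \<le> exp (- \<rho>) ^ k"
    using \<rho> exp_ge_add_one_self[of "- \<rho>"] by (intro power_mono) auto
  also have "exp (- \<rho>) ^ k = exp (- (\<rho> * k))" by (simp add: exp_of_nat_mult[symmetric] mult_ac)
  also have "exp (- (\<rho> * k)) \<le> exp (- (4 * l))"
    using k_bounds(1) \<rho> by (simp add: divide_le_eq mult_ac)
  also have "exp (- (4 * l)) = 1 / real n ^ 4"
    using n_gt_1 exp_of_nat_mult[of 4 l] by (simp add: exp_minus l(1) inverse_eq_divide)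
  finally show ?thesis using n_gt_1 by (simp add: eval_nat_numeral mult_left_mono)
qed

section \<open>Energy and block masses of light distributions\<close>

lemma M_pos: "M > 0" using M m_pos l_pos by simp

lemma M_square: "M\<^sup>2 = 28224 * h"
  unfolding M h by (simp add: power_divide power_mult_distrib)

text \<open>The uniform mean on the path, used as the reference value for both graphs; the mean on
  the cycle exceeds it only by \<open>O(g * \<eta>)\<close>.\<close>

definition base_energy :: real where "base_energy = mean_energy (\<lambda>_. 1 / n) \<rho> (n - 1)"

lemma base_energy_le: "base_energy \<le> 4 / (n * \<rho>)"
proof -
  have "base_energy \<le> 2 * (1 / n / \<rho>)\<^sup>2 * (\<rho> * real (n - 1) + 1)"
    unfolding base_energy_def using \<rho> by (intro mean_energy_const) auto
  also have "\<dots> \<le> 2 * (1 / n / \<rho>)\<^sup>2 * (2 * (n * \<rho>))"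
  proof (intro mult_left_mono)
    have "\<rho> * real (n - 1) \<le> \<rho> * n" using \<rho> by (intro mult_left_mono) auto
    then show "\<rho> * real (n - 1) + 1 \<le> 2 * (n * \<rho>)" using one_le_n_\<rho> by (simp add: mult_ac)
  qed auto
  also have "\<dots> = 4 / (n * \<rho>)" using n_gt_1 \<rho> by (simp add: field_simps power2_eq_square)
  finally show ?thesis .
qed

lemma base_energy_nonneg: "base_energy \<ge> 0"
  unfolding base_energy_def using \<rho> by (intro mean_energy_nonneg) auto

lemma h_base_energy_le: "h * base_energy \<le> 4 * (g\<^sup>2 * \<eta>)"
proof -
  have "h * base_energy \<le> h * (4 * (1 / (n * \<rho>)))"
    using base_energy_le h_pos by (intro mult_left_mono) auto
  also have "\<dots> = 4 * (h * (1 / (n * \<rho>)))" by simp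
  finally show ?thesis unfolding h_over_n_\<rho> .
qed

text \<open>The block lies within \<open>2 * k \<le> 10 * l / \<rho>\<close> vertices, which amounts
  to at most \<open>100 * l\<close> windows of at least \<open>1 / (10 * \<rho>)\<close> vertices,
  plus an incomplete one.\<close>

lemma light_linked_mass:
  fixes z :: "nat \<Rightarrow> real"
  assumes "light M w z" "\<And>y. z y \<ge> 0" "d \<notin> long_block n k" "x < n"
  shows "(\<Sum>y<n. z y * of_bool (linked d x y)) \<le> 101 * l * M"
proof -
  have "(\<Sum>y<n. z y * of_bool (linked d x y)) \<le> (\<Sum>y\<in>{x - k..<x - k + 2 * k}. z y)"
    using assms k_bounds by (intro linked_mass_le) auto
  also have "\<dots> \<le> (real (2 * k) / real (w + 1) + 1) * M"
    using assms M_pos by (intro light_interval) auto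
  also have "\<dots> \<le> (101 * l) * M"
  proof (intro mult_right_mono)
    have "real (2 * k) / real (w + 1) \<le> real (2 * k) * (10 * \<rho>)"
      using w_bounds(1) mult_left_mono[OF w_bounds(1), of "real (2 * k)"] by (simp add: divide_le_eq mult_ac)
    also have "\<dots> = 20 * (\<rho> * k)" by simp
    also have "\<rho> * k \<le> 5 * l" using k_bounds(2) \<rho> by (simp add: le_divide_eq mult_ac)
    finally show "real (2 * k) / real (w + 1) + 1 \<le> 101 * l" using l_pos by simp
  qed (use M_pos in simp)
  finally show ?thesis .
qed

lemma collision_constant_le: "4 * (2 * (101 * l * M)) / m + 2 / m\<^sup>2 \<le> 140000 * h"
proof -
  \<comment> \<open>Here \<open>135744 = 8 * 101 * 168\<close>.\<close>
  have "4 * (2 * (101 * l * M)) / m = 135744 * h" unfolding M h by (simp add: power2_eq_square)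
  moreover have "1 / m\<^sup>2 \<le> h" unfolding h using l_pos by (intro divide_right_mono) auto
  ultimately show ?thesis using h_pos by simp
qed

lemma light_energy_deviation:
  fixes z :: "nat \<Rightarrow> real"
  assumes light: "light M w z" and z: "\<And>y. z y \<ge> 0" "\<And>y. y \<ge> n \<Longrightarrow> z y = 0" and t: "t > 0"
  shows "measure_pmf.prob (cuts \<rho> (n - 1)) {d. \<bar>block_energy z d (n - 1) - mean_energy z \<rho> (n - 1)\<bar> \<ge> t}
    \<le> 20000000 * h * mean_energy z \<rho> (n - 1) / t\<^sup>2"
proof -
  let ?R = "right_mass \<rho> n z"
  have R: "(?R j)\<^sup>2 \<le> (11 * M)\<^sup>2" for j
    using right_mass_bounds[where \<rho> = \<rho> and j = j, OF z(2,1) light] M_pos \<rho> power_w_le by (intro power_mono) auto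
  have "measure_pmf.prob (cuts \<rho> (n - 1)) {d. \<bar>block_energy z d (n - 1) - mean_energy z \<rho> (n - 1)\<bar> \<ge> t}
    \<le> measure_pmf.expectation (cuts \<rho> (n - 1)) (\<lambda>d. (block_energy z d (n - 1) - mean_energy z \<rho> (n - 1))\<^sup>2) / t\<^sup>2"
    using t by (intro markov_pmf) (auto simp: abs_le_square_iff[symmetric])
  also have "\<dots> \<le> 4 * (11 * M)\<^sup>2 * mean_energy z \<rho> (n - 1) / t\<^sup>2"
  proof (intro divide_right_mono block_energy_variance[where R = ?R])
    show "?R j = z j + (1 - \<rho>) * ?R (Suc j)" for j by (rule right_mass_rec[OF z(2)])
    show "?R (Suc (n - 1)) = 0" using n_gt_1 z(2) by (simp add: right_mass_def)
  qed (use \<rho> R in auto)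
  \<comment> \<open>The exact factor is \<open>4 * 121 * 28224\<close>, about
    \<open>1.4 * 10 ^ 7\<close>.\<close>
  also have "\<dots> \<le> 20000000 * h * mean_energy z \<rho> (n - 1) / t\<^sup>2"
    using h_pos mean_energy_nonneg[of \<rho> z "n - 1"] \<rho>
    by (intro divide_right_mono mult_right_mono) (auto simp: power_mult_distrib M_square)
  finally show ?thesis .
qed

text \<open>Makes the deviation bound available for the uniform distribution too: a window has mass
  at most \<open>2 / (\<rho> * n) \<le> 2 / m\<close>.\<close>

lemma light_uniform: "light M w (pmf (pmf_of_set {..<n}))"
  unfolding light_def
proof
  fix a
  have u: "pmf (pmf_of_set {..<n}) y \<le> 1 / n" for y
    using n_gt_1 by (subst pmf_of_set) (auto simp: lessThan_empty_iff indicator_def)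
  have "(\<Sum>y\<in>{a..a + w}. pmf (pmf_of_set {..<n}) y) \<le> (\<Sum>y\<in>{a..a + w}. 1 / n)"
    by (intro sum_mono u)
  also have "\<dots> = (w + 1) / n" by simp
  also have "\<dots> \<le> (2 / \<rho>) / n"
  proof (intro divide_right_mono)
    have "\<rho> * (w + 1) \<le> 2" using w_bounds(2) \<rho> by (simp add: algebra_simps)
    then show "real (w + 1) \<le> 2 / \<rho>" using \<rho> by (simp add: le_divide_eq mult_ac)
  qed auto
  also have "\<dots> = 2 / (\<rho> * n)" by simp
  also have "\<dots> \<le> 2 / m" using m_le m_pos by (intro divide_left_mono) auto
  also have "\<dots> \<le> M" unfolding M using l_pos m_pos by (intro divide_right_mono) auto
  finally show "(\<Sum>y\<in>{a..a + w}. pmf (pmf_of_set {..<n}) y) \<le> M" .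
qed

text \<open>The bound for light distributions would allow mean counts of order
  \<open>l\<^sup>2\<close>. The exact masses give order \<open>l\<close> through
  \<open>m_le\<close>, as the maximum test requires.\<close>

lemma uniform_linked_mass:
  assumes "d \<notin> long_block n k" "x < n"
  shows "(\<Sum>y<n. 1 / n * of_bool (linked d x y)) \<le> 10 * l / (n * \<rho>)"
proof -
  have "(\<Sum>y<n. 1 / n * of_bool (linked d x y)) \<le> (\<Sum>y\<in>{x - k..<x - k + 2 * k}. 1 / real n)"
    using assms k_bounds by (intro linked_mass_le) auto
  also have "\<dots> = 2 * k / n" by simp
  also have "\<dots> \<le> 2 * (5 * l / \<rho>) / n" using k_bounds by (intro divide_right_mono mult_left_mono) auto
  finally show ?thesis by (simp add: mult_ac)
qed


lemma uniform_block_energy: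
  "block_energy (pmf (pmf_of_set {..<n})) d (n - 1) = block_energy (\<lambda>_. 1 / n) d (n - 1)"
  "mean_energy (pmf (pmf_of_set {..<n})) \<rho> (n - 1) = base_energy"
  unfolding base_energy_def using n_gt_1
  by (auto intro!: block_energy_cong mean_energy_cong simp: pmf_uniform)

context
  fixes E :: "nat set set"
  assumes E: "E \<in> {path_edges n, cycle_edges n}"
begin

section \<open>The threshold of the collision test\<close>

definition null_energy :: real where
  "null_energy = 1 / (real n)\<^sup>2 * (\<Sum>i<n. \<Sum>j<n. same_cell_prob E \<rho> i j)"

lemma null_energy_eq:
  "null_energy = measure_pmf.expectation (random_subgraph E \<rho>) (energy n (\<lambda>_. 1 / n))"
  unfolding expectation_energy[OF E] null_energy_def
  by (simp add: sum_distrib_left power2_eq_square)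

lemma integrable_random_subgraph:
  "integrable (measure_pmf (random_subgraph E \<rho>)) (f :: _ \<Rightarrow> real)"
  by (intro integrable_measure_pmf_finite finite_set_random_subgraph[OF E])

lemma base_energy_eq:
  "base_energy = measure_pmf.expectation (random_subgraph E \<rho>)
     (\<lambda>H. block_energy (\<lambda>_. 1 / n) (path_cuts n H) (n - 1))"
  unfolding base_energy_def mean_energy_def path_cuts_random_subgraph[OF E, symmetric] by simp

lemma null_energy_ge: "base_energy \<le> null_energy"
  unfolding base_energy_eq null_energy_eq using n_gt_1
  by (intro integral_mono integrable_random_subgraph block_energy_le_energy) auto

lemma uniform_energy_le:
  assumes "H \<subseteq> cycle_edges n" "path_cuts n H \<notin> long_block n k"
  shows "energy n (\<lambda>_. 1 / n) H \<le> block_energy (\<lambda>_. 1 / n) (path_cuts n H) (n - 1) + 200 * (g * \<eta>)"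
proof -
  have "energy n (\<lambda>_. 1 / n) H \<le> block_energy (\<lambda>_. 1 / n) (path_cuts n H) (n - 1) + 2 * (10 * l / (n * \<rho>))\<^sup>2"
    using assms n_gt_1 by (intro energy_le_block_energy uniform_linked_mass) auto
  also have "2 * (10 * l / (n * \<rho>))\<^sup>2 = 200 * (l\<^sup>2 / (n * \<rho>)\<^sup>2)"
    by (simp add: power_divide power_mult_distrib)
  also have "\<dots> \<le> 200 * (g * \<eta>)" using l2_le by simp
  finally show ?thesis by simp
qed

lemma null_energy_le: "null_energy \<le> base_energy + 201 * (g * \<eta>)"
proof -
  let ?T = "\<lambda>H. block_energy (\<lambda>_. 1 / n) (path_cuts n H) (n - 1)"
  let ?I = "indicator (path_cuts n -` long_block n k) :: _ \<Rightarrow> real"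
  let ?G = "random_subgraph E \<rho>"
  have "null_energy \<le> measure_pmf.expectation ?G (\<lambda>H. ?T H + 200 * (g * \<eta>) + ?I H)"
    unfolding null_energy_eq
  proof (intro integral_mono_AE integrable_random_subgraph, unfold AE_measure_pmf_iff, intro ballI)
    fix H assume "H \<in> set_pmf ?G"
    then have H: "H \<subseteq> cycle_edges n" by (rule random_subgraph_subset[OF E])
    show "energy n (\<lambda>_. 1 / n) H \<le> ?T H + 200 * (g * \<eta>) + ?I H"
    proof (cases "path_cuts n H \<in> long_block n k")
      case True
      \<comment> \<open>If some block is long, the trivial bound \<open>1\<close> suffices: the
        event has probability at most \<open>1 / n ^ 3 \<le> g * \<eta>\<close>.\<close>
      have "energy n (\<lambda>_. 1 / n) H \<le> 1"
        unfolding energy_uniform[symmetric] using n_gt_1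
        by (intro energy_le_one) (auto simp: set_pmf_of_set lessThan_empty_iff)
      moreover have "0 \<le> ?T H" by (rule order_trans[OF zero_le_power2 block_energy_ge])
      ultimately show ?thesis using True g_pos \<eta>_bounds by (simp add: add_increasing)
    next
      case False
      then show ?thesis using uniform_energy_le[OF H] by simp
    qed
  qed
  also have "\<dots> = base_energy + 200 * (g * \<eta>) + measure_pmf.prob ?G (path_cuts n -` long_block n k)"
    unfolding base_energy_eq by (simp add: integrable_random_subgraph)
  also have "measure_pmf.prob ?G (path_cuts n -` long_block n k) = measure_pmf.prob (cuts \<rho> (n - 1)) (long_block n k)"
    unfolding path_cuts_random_subgraph[OF E, symmetric] by simp
  also have "\<dots> \<le> g * \<eta>" using prob_long n3_le by linarith
  finally show ?thesis by (simp add: mult_ac add_ac)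
qed

text \<open>The choice \<open>\<beta> = 1/16\<close> places the threshold at a quarter of the
  guaranteed gap \<open>g / 4\<close>, with room for fluctuations of cuts and samples on both
  sides.\<close>

lemma threshold_eq: "1 / (real n)\<^sup>2 * (\<Sum>i<n. \<Sum>j<n. same_cell_prob E \<rho> i j) + 1 / 16 * (1 / n) * \<epsilon>\<^sup>2 * \<rho>
    = null_energy + g / 16"
  by (simp add: null_energy_def g)

lemma inverse_n_le: "1 / real n \<le> 1 / 10 ^ 7" "1 / real n ^ 3 \<le> 1 / 10 ^ 7"
proof -
  have "10 ^ 7 \<le> real n" using l(2) l_le_n by linarith
  moreover have "real n \<le> real n ^ 3" using n_gt_1 power_increasing[of 1 3 "real n"] by simp
  ultimately have "10 ^ 7 \<le> real n" "10 ^ 7 \<le> real n ^ 3" by linarith+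
  then show "1 / real n \<le> 1 / 10 ^ 7" "1 / real n ^ 3 \<le> 1 / 10 ^ 7"
    using n_gt_1 by (auto intro!: divide_left_mono simp del: power_eq_0_iff)
qed

section \<open>Completeness: the uniform distribution\<close>

lemma uniform_reject_prob:
  "measure_pmf.prob (execution n E \<rho> (pmf_of_set {..<n}) (tester 42 (1/16) 1 n E \<epsilon> \<rho>))
     {\<omega>. accepted \<omega> = False} \<le> 1 / 3"
proof -
  let ?\<nu> = "pmf_of_set {..<n}"
  let ?T = "\<lambda>d. block_energy (\<lambda>_. 1 / n) d (n - 1)"
  \<comment> \<open>The margin \<open>g / 16\<close> is split into \<open>g / 64\<close> for the
    cuts, \<open>g / 64\<close> for closing the cycle and \<open>g / 32\<close> for the
    samples.\<close>
  define Bad where "Bad = long_block n k \<union> {d. \<bar>?T d - base_energy\<bar> \<ge> g / 64}"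
  \<comment> \<open>The maximum test accounts for \<open>1 / n\<close>. In the Chebyshev term,
    \<open>5\<close> bounds \<open>h * S / (g\<^sup>2 * \<eta>)\<close> and
    \<open>1024 = 32\<^sup>2\<close>.\<close>
  define e where "e = 1 / n + 140000 * 5 * 1024 * \<eta>"
  have \<nu>: "set_pmf ?\<nu> \<subseteq> {..<n}" using n_gt_1 by (auto simp: set_pmf_of_set lessThan_empty_iff)
  have "measure_pmf.prob (cuts \<rho> (n - 1)) {d. \<bar>?T d - base_energy\<bar> \<ge> g / 64}
      \<le> 20000000 * h * base_energy / (g / 64)\<^sup>2"
    using light_energy_deviation[OF light_uniform pmf_nonneg pmf_zero, of "g / 64"] g_pos \<nu>
    unfolding uniform_block_energy by simp
  also have "\<dots> = 20000000 * (h * base_energy) / (g / 64)\<^sup>2" by simp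
  also have "\<dots> \<le> 20000000 * (4 * (g\<^sup>2 * \<eta>)) / (g / 64)\<^sup>2"
    using h_base_energy_le by (intro divide_right_mono mult_left_mono) auto
  also have "\<dots> = 20000000 * 4 * 4096 * \<eta>" using g_pos by (simp add: power_divide)
  finally have "measure_pmf.prob (cuts \<rho> (n - 1)) Bad \<le> 1 / n ^ 3 + 20000000 * 4 * 4096 * \<eta>"
    using prob_long measure_Un_le[of "long_block n k" "measure_pmf (cuts \<rho> (n - 1))" "{d. \<bar>?T d - base_energy\<bar> \<ge> g / 64}"]
    unfolding Bad_def by simp
  moreover have "measure_pmf.prob (execution n E \<rho> ?\<nu> (tester 42 (1/16) 1 n E \<epsilon> \<rho>)) {\<omega>. accepted \<omega> = False}
      \<le> measure_pmf.prob (cuts \<rho> (n - 1)) Bad + e"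
  proof (rule prob_execution_tester_le[OF E])
    show "e \<ge> 0" using \<eta>_bounds by (simp add: e_def)
    fix H r
    assume H: "H \<subseteq> cycle_edges n" "path_cuts n H \<notin> Bad"
      and r: "\<And>x. x < n \<Longrightarrow> r x \<in> cell_of H x \<and> r x < n" "\<And>x y. cell_of H x = cell_of H y \<Longrightarrow> r x = r y"
    let ?p = "map_pmf r ?\<nu>"
    define S where "S = (\<Sum>v<n. (pmf ?p v)\<^sup>2)"
    define A where "A = 20 * l / m"
    have nl: "path_cuts n H \<notin> long_block n k" and dev: "\<bar>?T (path_cuts n H) - base_energy\<bar> < g / 64"
      using H(2) by (auto simp: Bad_def)
    have S: "S = energy n (\<lambda>_. 1 / n) H"
      unfolding S_def energy_uniform[symmetric] by (rule collision_energy[OF r \<nu>])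
    have S_le: "S \<le> base_energy + g / 32"
      using uniform_energy_le[OF H(1) nl] dev g_pos g_\<eta>_small unfolding S by linarith
    have A: "pmf ?p v \<le> A" for v
    proof (rule pmf_representatives_le[OF r \<nu>])
      fix x assume "x < n"
      have "(\<Sum>y<n. pmf ?\<nu> y * of_bool (cell_of H x = cell_of H y)) =
          (\<Sum>y<n. 1 / n * of_bool (cell_of H x = cell_of H y))"
        by (intro sum.cong) (auto simp: pmf_uniform)
      also have "\<dots> \<le> 2 * (10 * l / (n * \<rho>))"
        using n_gt_1 \<open>x < n\<close> nl by (intro cell_mass_le[OF H(1)] uniform_linked_mass) auto
      also have "\<dots> = 20 * l / (\<rho> * n)" by (simp add: mult_ac)
      also have "\<dots> \<le> A" unfolding A_def using m_le m_pos l_pos by (intro divide_left_mono) auto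
      finally show "(\<Sum>y<n. pmf ?\<nu> y * of_bool (cell_of H x = cell_of H y)) \<le> A" .
    qed (use l_pos m_pos in \<open>auto simp: A_def\<close>)
    have "measure_pmf.prob (poisson_sample m ?p) {vs. decision 42 (1/16) 1 n E \<epsilon> \<rho> vs = False} \<le>
      real n * exp (2 * (m * A) - 42 * ln n) + (4 * A / m + 2 / m\<^sup>2) * S / (g / 32)\<^sup>2"
      unfolding m S_def
    proof (rule reject_prob_le)
      show "(\<Sum>v<n. (pmf ?p v)\<^sup>2) + g / 32 \<le>
          1 / (real n)\<^sup>2 * (\<Sum>i<n. \<Sum>j<n. same_cell_prob E \<rho> i j) + 1 / 16 * (1 / n) * \<epsilon>\<^sup>2 * \<rho>"
        unfolding threshold_eq S_def[symmetric] using S_le null_energy_ge by simp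
    qed (use n_gt_1 m_pos m finite_set_representatives[OF r \<nu>] A g_pos in auto)
    also have "\<dots> \<le> e"
      unfolding e_def
    proof (rule add_mono)
      have "2 * (m * A) - 42 * ln n = - (2 * l)" using m_pos by (simp add: A_def l(1))
      also have "exp \<dots> = 1 / real n ^ 2"
        using n_gt_1 exp_of_nat_mult[of 2 l] by (simp add: exp_minus l(1) inverse_eq_divide)
      finally show "real n * exp (2 * (m * A) - 42 * ln n) \<le> 1 / n"
        using n_gt_1 by (simp add: power2_eq_square)
      have "4 * A / m = 80 * (l / m\<^sup>2)" by (simp add: A_def power2_eq_square)
      moreover have "l / m\<^sup>2 \<le> h" unfolding h
        using l_pos by (intro divide_right_mono) (auto simp: power2_eq_square)
      moreover have "1 / m\<^sup>2 \<le> h" unfolding h using l_pos by (intro divide_right_mono) auto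
      ultimately have c: "4 * A / m + 2 / m\<^sup>2 \<le> 140000 * h" using h_pos by simp
      have "h * (g / 32) \<le> (g * \<eta>) * (g / 32)" using h_le g_pos by (intro mult_right_mono) auto
      then have "h * S \<le> 4 * (g\<^sup>2 * \<eta>) + (g * \<eta>) * (g / 32)"
        using mult_left_mono[OF S_le, of h] h_base_energy_le h_pos by (simp add: distrib_left)
      also have "\<dots> \<le> 5 * (g\<^sup>2 * \<eta>)" using g_pos \<eta>_bounds by (simp add: power2_eq_square)
      finally have hS: "h * S \<le> 5 * (g\<^sup>2 * \<eta>)" .
      have "(4 * A / m + 2 / m\<^sup>2) * S \<le> 140000 * h * S"
        using c by (intro mult_right_mono) (auto simp: S_def sum_nonneg)
      also have "\<dots> \<le> 140000 * (5 * (g\<^sup>2 * \<eta>))"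
        unfolding mult.assoc[of 140000 h S] using hS by (intro mult_left_mono) simp_all
      finally have "(4 * A / m + 2 / m\<^sup>2) * S / (g / 32)\<^sup>2 \<le> 140000 * (5 * (g\<^sup>2 * \<eta>)) / (g / 32)\<^sup>2"
        by (intro divide_right_mono) auto
      then show "(4 * A / m + 2 / m\<^sup>2) * S / (g / 32)\<^sup>2 \<le> 140000 * 5 * 1024 * \<eta>"
        using g_pos by (simp add: power_divide)
    qed
    finally show "measure_pmf.prob (poisson_sample (tester_rate 1 n \<epsilon> \<rho>) ?p)
        {vs. decision 42 (1/16) 1 n E \<epsilon> \<rho> vs = False} \<le> e"
      unfolding m .
  qed
  ultimately show ?thesis using \<eta>_bounds inverse_n_le unfolding e_def by simp
qed


section \<open>Soundness: distributions far from uniform\<close>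

text \<open>By Cauchy-Schwarz the deviation from uniform has squared norm at least
  \<open>4 * \<epsilon>\<^sup>2 / n\<close>, hence mean energy at least \<open>g\<close>. Half of it
  survives the cross term with the constant, up to \<open>10 * (g * \<eta>)\<close>.\<close>

lemma mean_energy_gap:
  assumes \<mu>: "set_pmf \<mu> \<subseteq> {..<n}" and far: "tv_dist n \<mu> (pmf_of_set {..<n}) > \<epsilon>"
  shows "base_energy + g / 4 \<le> mean_energy (pmf \<mu>) \<rho> (n - 1)"
proof -
  define z where "z i = pmf \<mu> i - 1 / n" for i
  have idx: "{..n - 1} = {..<n}" using n_gt_1 by auto
  have "(\<Sum>i<n. pmf \<mu> i) = 1" using \<mu> by (intro sum_pmf_eq_1) auto
  then have z0: "(\<Sum>i\<le>n - 1. z i) = 0" unfolding idx z_def using n_gt_1 by (simp add: sum_subtractf)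
  have "2 * \<epsilon> < (\<Sum>i<n. \<bar>z i\<bar>)"
    using far by (simp add: tv_dist_def z_def pmf_uniform)
  then have "(2 * \<epsilon>)\<^sup>2 \<le> (\<Sum>i<n. \<bar>z i\<bar>)\<^sup>2" using \<epsilon> by (intro power_mono) auto
  also have "\<dots> \<le> (\<Sum>i<n. \<bar>z i\<bar>\<^sup>2) * card {..<n}" by (rule sum_squared_le_sum_of_squares)
  finally have z2: "4 * \<epsilon>\<^sup>2 / n \<le> (\<Sum>i<n. (z i)\<^sup>2)" using n_gt_1 by (simp add: divide_le_eq power_mult_distrib)
  have "g = \<rho> / 4 * (4 * \<epsilon>\<^sup>2 / n)" by (simp add: g)
  also have "\<dots> \<le> \<rho> / 4 * (\<Sum>i<n. (z i)\<^sup>2)" using z2 \<rho> by (intro mult_left_mono) auto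
  also have "\<dots> \<le> mean_energy z \<rho> (n - 1)"
    unfolding idx[symmetric] using \<rho> by (intro mean_energy_lower) auto
  finally have gz: "g \<le> mean_energy z \<rho> (n - 1)" .
  have "base_energy + mean_energy z \<rho> (n - 1) / 2 - 10 * (1 / n / \<rho>)\<^sup>2 \<le>
      mean_energy (\<lambda>i. 1 / n + z i) \<rho> (n - 1)"
    unfolding base_energy_def using \<rho> z0 by (intro mean_energy_perturb) auto
  then have "base_energy + mean_energy z \<rho> (n - 1) / 2 - 10 * (1 / n / \<rho>)\<^sup>2 \<le>
      mean_energy (pmf \<mu>) \<rho> (n - 1)"
    by (simp add: z_def)
  moreover have "(1 / n / \<rho>)\<^sup>2 \<le> g * \<eta>" using one_le_l2 by (simp add: power_divide power_mult_distrib)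
  ultimately show ?thesis using gz g_pos g_\<eta>_small by linarith
qed

text \<open>The excess \<open>\<Delta>\<close> of the mean energy may be far above \<open>g\<close>,
  and the variances grow with it. All deviations are therefore measured in units of
  \<open>\<Delta>\<close>.\<close>

lemma light_accept_prob:
  assumes \<mu>: "set_pmf \<mu> \<subseteq> {..<n}" and far: "tv_dist n \<mu> (pmf_of_set {..<n}) > \<epsilon>"
    and light: "light M w (pmf \<mu>)"
  shows "measure_pmf.prob (execution n E \<rho> \<mu> (tester 42 (1/16) 1 n E \<epsilon> \<rho>))
     {\<omega>. accepted \<omega> = True} \<le> 1 / 3"
proof -
  let ?T = "\<lambda>d. block_energy (pmf \<mu>) d (n - 1)"
  define \<Delta> where "\<Delta> = mean_energy (pmf \<mu>) \<rho> (n - 1) - base_energy"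
  have \<Delta>: "g / 4 \<le> \<Delta>" using mean_energy_gap[OF \<mu> far] by (simp add: \<Delta>_def)
  then have \<Delta>0: "\<Delta> > 0" using g_pos by simp
  have "g \<le> 4 * \<Delta>" using \<Delta> by simp
  have "g\<^sup>2 \<le> (4 * \<Delta>)\<^sup>2" using \<Delta> g_pos by (intro power_mono) auto
  then have "g\<^sup>2 * \<eta> \<le> (4 * \<Delta>)\<^sup>2 * \<eta>" using \<eta>_bounds by (intro mult_right_mono) auto
  then have hb: "h * base_energy \<le> 64 * (\<Delta>\<^sup>2 * \<eta>)"
    using h_base_energy_le by (simp add: power_mult_distrib)
  have "h * \<Delta> \<le> (4 * \<Delta> * \<eta>) * \<Delta>"
    using order_trans[OF h_le mult_right_mono[OF \<open>g \<le> 4 * \<Delta>\<close>, of \<eta>]] \<eta>_bounds \<Delta>0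
    by (intro mult_right_mono) auto
  then have h\<Delta>: "h * \<Delta> \<le> 4 * (\<Delta>\<^sup>2 * \<eta>)" by (simp add: power2_eq_square mult_ac)
  \<comment> \<open>Of the excess, \<open>\<Delta> / 4\<close> is given to the cuts and
    \<open>\<Delta> / 2\<close> to the threshold, which leaves \<open>\<Delta> / 4\<close> to the
    samples.\<close>
  define Bad where "Bad = long_block n k \<union> {d. \<bar>?T d - mean_energy (pmf \<mu>) \<rho> (n - 1)\<bar> \<ge> \<Delta> / 4}"
  \<comment> \<open>Here \<open>1072 = 16 * 64 + 12 * 4\<close>, from the bounds \<open>hb\<close>
    and \<open>h\<Delta>\<close>.\<close>
  define e where "e = 140000 * 1072 * \<eta>"
  have "measure_pmf.prob (cuts \<rho> (n - 1)) {d. \<bar>?T d - mean_energy (pmf \<mu>) \<rho> (n - 1)\<bar> \<ge> \<Delta> / 4}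
      \<le> 20000000 * h * mean_energy (pmf \<mu>) \<rho> (n - 1) / (\<Delta> / 4)\<^sup>2"
    using light_energy_deviation[OF light pmf_nonneg pmf_zero[OF \<mu>], of "\<Delta> / 4"] \<Delta>0 by simp
  also have "\<dots> = 20000000 * (h * base_energy + h * \<Delta>) / (\<Delta> / 4)\<^sup>2" by (simp add: \<Delta>_def algebra_simps)
  also have "\<dots> \<le> 20000000 * (68 * (\<Delta>\<^sup>2 * \<eta>)) / (\<Delta> / 4)\<^sup>2"
    using hb h\<Delta> by (intro divide_right_mono mult_left_mono) auto
  also have "\<dots> = 20000000 * 68 * 16 * \<eta>" using \<Delta>0 by (simp add: power_divide)
  finally have "measure_pmf.prob (cuts \<rho> (n - 1)) Bad \<le> 1 / n ^ 3 + 20000000 * 68 * 16 * \<eta>"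
    using prob_long measure_Un_le[of "long_block n k" "measure_pmf (cuts \<rho> (n - 1))"
        "{d. \<bar>?T d - mean_energy (pmf \<mu>) \<rho> (n - 1)\<bar> \<ge> \<Delta> / 4}"]
    unfolding Bad_def by simp
  moreover have "measure_pmf.prob (execution n E \<rho> \<mu> (tester 42 (1/16) 1 n E \<epsilon> \<rho>)) {\<omega>. accepted \<omega> = True}
      \<le> measure_pmf.prob (cuts \<rho> (n - 1)) Bad + e"
  proof (rule prob_execution_tester_le[OF E])
    show "e \<ge> 0" using \<eta>_bounds by (simp add: e_def)
    fix H r
    assume H: "H \<subseteq> cycle_edges n" "path_cuts n H \<notin> Bad"
      and r: "\<And>x. x < n \<Longrightarrow> r x \<in> cell_of H x \<and> r x < n" "\<And>x y. cell_of H x = cell_of H y \<Longrightarrow> r x = r y"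
    let ?p = "map_pmf r \<mu>"
    define A where "A = 2 * (101 * l * M)"
    define thr where "thr = null_energy + g / 16"
    have nl: "path_cuts n H \<notin> long_block n k"
      and dev: "\<bar>?T (path_cuts n H) - mean_energy (pmf \<mu>) \<rho> (n - 1)\<bar> < \<Delta> / 4"
      using H(2) by (auto simp: Bad_def)
    have S: "(\<Sum>v<n. (pmf ?p v)\<^sup>2) = energy n (pmf \<mu>) H" by (rule collision_energy[OF r \<mu>])
    have "?T (path_cuts n H) \<le> energy n (pmf \<mu>) H" using n_gt_1 by (intro block_energy_le_energy) auto
    then have S_ge: "base_energy + \<Delta> * (3 / 4) \<le> energy n (pmf \<mu>) H"
      using dev \<Delta>_def by linarith
    have thr_le: "thr \<le> base_energy + \<Delta> / 2"
      unfolding thr_def using null_energy_le \<Delta> g_pos g_\<eta>_small by linarith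
    have thr0: "thr \<ge> 0" unfolding thr_def using null_energy_ge base_energy_nonneg g_pos by simp
    have A: "pmf ?p v \<le> A" for v
      unfolding A_def
    proof (rule pmf_representatives_le[OF r \<mu>])
      fix x assume "x < n"
      then show "(\<Sum>y<n. pmf \<mu> y * of_bool (cell_of H x = cell_of H y)) \<le> 2 * (101 * l * M)"
        using n_gt_1 nl by (intro cell_mass_le[OF H(1)] light_linked_mass light) auto
    qed (use l_pos M_pos in auto)
    have "measure_pmf.prob (poisson_sample m ?p) {vs. decision 42 (1/16) 1 n E \<epsilon> \<rho> vs = True} \<le>
      (4 * A / m + 2 / m\<^sup>2) * (1 / (\<Delta> / 4) + thr / (\<Delta> / 4)\<^sup>2)"
      unfolding m thr_def threshold_eq[symmetric]
    proof (rule accept_prob_le)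
      show "1 / (real n)\<^sup>2 * (\<Sum>i<n. \<Sum>j<n. same_cell_prob E \<rho> i j) + 1 / 16 * (1 / n) * \<epsilon>\<^sup>2 * \<rho> + \<Delta> / 4 \<le>
          (\<Sum>v<n. (pmf ?p v)\<^sup>2)"
        unfolding threshold_eq thr_def[symmetric] S using S_ge thr_le by simp
      show "0 \<le> 1 / (real n)\<^sup>2 * (\<Sum>i<n. \<Sum>j<n. same_cell_prob E \<rho> i j) + 1 / 16 * (1 / n) * \<epsilon>\<^sup>2 * \<rho>"
        unfolding threshold_eq thr_def[symmetric] by (rule thr0)
    qed (use n_gt_1 m_pos m finite_set_representatives[OF r \<mu>] A \<Delta>0 l_pos M_pos in \<open>auto simp: A_def\<close>)
    also have "\<dots> \<le> (140000 * h) * (1 / (\<Delta> / 4) + (base_energy + \<Delta> / 2) / (\<Delta> / 4)\<^sup>2)"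
      unfolding A_def using thr_le thr0 \<Delta>0 h_pos collision_constant_le
      by (intro mult_mono add_mono divide_right_mono) auto
    also have "\<dots> = 140000 * (12 * (h * \<Delta>) + 16 * (h * base_energy)) / \<Delta>\<^sup>2"
      using \<Delta>0 by (simp add: field_simps power2_eq_square)
    also have "\<dots> \<le> 140000 * (1072 * (\<Delta>\<^sup>2 * \<eta>)) / \<Delta>\<^sup>2"
      using hb h\<Delta> by (intro divide_right_mono mult_left_mono) auto
    also have "\<dots> = e" using \<Delta>0 by (simp add: e_def)
    finally show "measure_pmf.prob (poisson_sample (tester_rate 1 n \<epsilon> \<rho>) ?p)
        {vs. decision 42 (1/16) 1 n E \<epsilon> \<rho> vs = True} \<le> e"
      unfolding m .
  qed
  ultimately show ?thesis using \<eta>_bounds inverse_n_le unfolding e_def by simp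
qed

lemma heavy_accept_prob:
  assumes \<mu>: "set_pmf \<mu> \<subseteq> {..<n}" and heavy: "\<not> light M w (pmf \<mu>)"
  shows "measure_pmf.prob (execution n E \<rho> \<mu> (tester 42 (1/16) 1 n E \<epsilon> \<rho>))
     {\<omega>. accepted \<omega> = True} \<le> 1 / 3"
proof -
  obtain a where a: "M < (\<Sum>y\<in>{a..a + w}. pmf \<mu> y)" using heavy by (auto simp: light_def not_le)
  have "a < n"
  proof (rule ccontr)
    assume "\<not> a < n"
    then have "(\<Sum>y\<in>{a..a + w}. pmf \<mu> y) = 0" by (intro sum.neutral) (auto intro: pmf_zero[OF \<mu>])
    then show False using a M_pos by simp
  qed
  \<comment> \<open>The window may stick out of the vertex set. Only its edges up to vertex
    \<open>n - 1\<close> have to survive, and beyond that vertex there is no mass.\<close>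
  define b where "b = min w (n - 1 - a)"
  define Good where "Good = {d :: nat \<Rightarrow> bool. \<forall>t\<in>{a..<a + b}. \<not> d t}"
  \<comment> \<open>At most \<open>w\<close> edges must survive; Bernoulli's inequality and
    \<open>\<rho> * w \<le> 1/10\<close> leave a failure probability of at most
    \<open>1/10\<close>.\<close>
  have "1 - \<rho> * w \<le> (1 - \<rho>) ^ w"
    using Bernoulli_inequality[of "- \<rho>" w] \<rho> by (simp add: mult_ac)
  also have "\<dots> \<le> (1 - \<rho>) ^ b" using \<rho> by (intro power_decreasing) (auto simp: b_def)
  also have "\<dots> = measure_pmf.prob (cuts \<rho> (n - 1)) Good"
    unfolding Good_def using \<rho> \<open>a < n\<close> by (intro prob_linked_interval[symmetric]) (auto simp: b_def)
  finally have "measure_pmf.prob (cuts \<rho> (n - 1)) (- Good) \<le> 1 / 10"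
    using w_bounds(2) measure_pmf.prob_compl[of Good "cuts \<rho> (n - 1)"] by (simp add: Compl_eq_Diff_UNIV)
  moreover have "measure_pmf.prob (execution n E \<rho> \<mu> (tester 42 (1/16) 1 n E \<epsilon> \<rho>)) {\<omega>. accepted \<omega> = True}
      \<le> measure_pmf.prob (cuts \<rho> (n - 1)) (- Good) + 1 / n"
  proof (rule prob_execution_tester_le[OF E])
    fix H r
    assume H: "H \<subseteq> cycle_edges n" "path_cuts n H \<notin> - Good"
      and r: "\<And>x. x < n \<Longrightarrow> r x \<in> cell_of H x \<and> r x < n" "\<And>x y. cell_of H x = cell_of H y \<Longrightarrow> r x = r y"
    let ?p = "map_pmf r \<mu>"
    have cell: "cell_of H a = cell_of H y" if "y \<in> {a..a + w}" "y < n" for y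
    proof (rule same_cell_if_linked[OF \<open>a < n\<close> that(2)])
      show "linked (path_cuts n H) a y"
        unfolding linked_def
      proof (intro allI impI)
        fix t assume "min a y \<le> t \<and> t < max a y"
        then have "t \<in> {a..<a + b}" using that \<open>a < n\<close> unfolding b_def atLeastLessThan_iff atLeastAtMost_iff by arith
        then show "\<not> path_cuts n H t" using H(2) by (simp add: Good_def)
      qed
    qed
    have "M \<le> (\<Sum>y\<in>{a..a + w} \<inter> {..<n}. pmf \<mu> y)"
    proof -
      have "(\<Sum>y\<in>{a..a + w}. pmf \<mu> y) = (\<Sum>y\<in>{a..a + w} \<inter> {..<n}. pmf \<mu> y)"
        by (intro sum.mono_neutral_right) (auto intro: pmf_zero[OF \<mu>])
      then show ?thesis using a by simp
    qed
    also have "\<dots> \<le> (\<Sum>y<n. pmf \<mu> y * of_bool (cell_of H a = cell_of H y))"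
    proof -
      have "(\<Sum>y\<in>{a..a + w} \<inter> {..<n}. pmf \<mu> y) =
          (\<Sum>y\<in>{a..a + w} \<inter> {..<n}. pmf \<mu> y * of_bool (cell_of H a = cell_of H y))"
        using cell by (intro sum.cong) auto
      also have "\<dots> \<le> (\<Sum>y<n. pmf \<mu> y * of_bool (cell_of H a = cell_of H y))"
        by (intro sum_mono2) auto
      finally show ?thesis .
    qed
    also have "\<dots> = pmf ?p (r a)" by (rule pmf_representative[OF r \<mu> \<open>a < n\<close>, symmetric])
    finally have "m * M \<le> m * pmf ?p (r a)" using m_pos by (intro mult_left_mono) auto
    then have "4 * 42 * ln n \<le> m * pmf ?p (r a)" using m_pos by (simp add: M l(1))
    then have "measure_pmf.prob (poisson_sample m ?p) {vs. decision 42 (1/16) 1 n E \<epsilon> \<rho> vs = True}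
        \<le> exp (- 42 * ln n)"
      unfolding m using n_gt_1 m_pos m finite_set_representatives[OF r \<mu>] r(1)[OF \<open>a < n\<close>]
      by (intro accept_prob_heavy_le[where v = "r a"]) auto
    also have "\<dots> \<le> exp (- ln n)" using n_gt_1 by simp
    also have "\<dots> = 1 / n" using n_gt_1 by (simp add: exp_minus inverse_eq_divide)
    finally show "measure_pmf.prob (poisson_sample (tester_rate 1 n \<epsilon> \<rho>) ?p)
        {vs. decision 42 (1/16) 1 n E \<epsilon> \<rho> vs = True} \<le> 1 / n"
      unfolding m .
  qed simp
  ultimately show ?thesis using inverse_n_le by simp
qed

lemma uniformity_tester_tester:
  "uniformity_tester n E \<epsilon> \<rho> (1 / 3) (tester 42 (1/16) 1 n E \<epsilon> \<rho>)"
  unfolding uniformity_tester_def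
proof (intro ballI conjI impI)
  let ?X = "\<lambda>\<mu>. execution n E \<rho> \<mu> (tester 42 (1/16) 1 n E \<epsilon> \<rho>)"
  fix \<mu> assume "\<mu> \<in> distributions n"
  then have \<mu>: "set_pmf \<mu> \<subseteq> {..<n}" by (simp add: distributions_def)
  have compl: "measure_pmf.prob (?X \<mu>) {\<omega>. accepted \<omega>} = 1 - measure_pmf.prob (?X \<mu>) {\<omega>. \<not> accepted \<omega>}"
    using measure_pmf.prob_compl[of "{\<omega>. \<not> accepted \<omega>}" "?X \<mu>"] by (simp add: set_diff_eq)
  show "1 - 1 / 3 \<le> measure_pmf.prob (?X \<mu>) {\<omega>. accepted \<omega>}" if "\<mu> = pmf_of_set {..<n}"
    using uniform_reject_prob compl that by simp
  show "1 - 1 / 3 \<le> measure_pmf.prob (?X \<mu>) {\<omega>. \<not> accepted \<omega>}" if "\<epsilon> < tv_dist n \<mu> (pmf_of_set {..<n})"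
    using light_accept_prob[OF \<mu> that] heavy_accept_prob[OF \<mu>] compl
    by (cases "light M w (pmf \<mu>)") auto
qed

end

end

lemma uniformity_tester_tester_if_large:
  assumes "10 ^ 7 \<le> ln n" "0 < \<epsilon>" "\<epsilon> \<le> 1" "0 < \<rho>" "\<rho> \<le> 1" "ln n ^ 4 \<le> n * \<epsilon> ^ 4 * \<rho> ^ 5"
    "E \<in> {path_edges n, cycle_edges n}"
  shows "uniformity_tester n E \<epsilon> \<rho> (1 / 3) (tester 42 (1/16) 1 n E \<epsilon> \<rho>)"
  by (rule uniformity_tester_tester[OF refl assms(1-6) refl refl refl refl refl refl refl assms(7)])

text \<open>The fifth power clears all fractional exponents of the resolution hypothesis with
  \<open>L = 1\<close>.\<close>

lemma resolution_bound:
  fixes n :: nat and \<epsilon> \<rho> :: real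
  assumes "n > 1" "0 < \<epsilon>" "0 < \<rho>" and *: "\<rho> \<ge> 1 * ln n powr (4/5) / (n powr (1/5) * \<epsilon> powr (4/5))"
  shows "ln n ^ 4 \<le> n * \<epsilon> ^ 4 * \<rho> ^ 5"
proof -
  have l: "ln n > 0" using assms(1) by simp
  have p: "(x powr (4/5)) ^ 5 = x ^ 4" if "x > 0" for x :: real
    using that by (simp add: powr_power)
  have q: "(real n powr (1/5)) ^ 5 = n" using assms(1) by (simp add: powr_power)
  have "ln n powr (4/5) \<le> \<rho> * (n powr (1/5) * \<epsilon> powr (4/5))"
    using * assms by (simp add: divide_le_eq)
  then have "(ln n powr (4/5)) ^ 5 \<le> (\<rho> * (n powr (1/5) * \<epsilon> powr (4/5))) ^ 5"
    by (intro power_mono) auto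
  then show ?thesis
    unfolding power_mult_distrib p[OF l] p[OF assms(2)] q by (simp add: mult_ac)
qed

theorem theorem4p35:
  shows "\<exists>\<alpha> \<beta> c L C1 C2 :: real.
    \<alpha> > 0 \<and> \<beta> > 0 \<and> c > 0 \<and> L > 0 \<and> C1 > 0 \<and> C2 > 0 \<and>
    (\<forall>\<^sub>F n :: nat in sequentially. \<forall>\<epsilon>\<in>{0<..1}. \<forall>\<rho>\<in>{0<..1}.
       \<rho> \<ge> L * ln n powr (4/5) / (n powr (1/5) * \<epsilon> powr (4/5)) \<longrightarrow>
       (\<forall>E\<in>{path_edges n, cycle_edges n}.
          uniformity_tester n E \<epsilon> \<rho> (1/3) (tester \<alpha> \<beta> c n E \<epsilon> \<rho>) \<and>
          ennreal (C1 * (sqrt n / (\<epsilon>\<^sup>2 * \<rho> powr (3/2)) * (ln n)\<^sup>2))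
            \<le> sample_complexity n E \<rho> (tester \<alpha> \<beta> c n E \<epsilon> \<rho>) \<and>
          sample_complexity n E \<rho> (tester \<alpha> \<beta> c n E \<epsilon> \<rho>)
            \<le> ennreal (C2 * (sqrt n / (\<epsilon>\<^sup>2 * \<rho> powr (3/2)) * (ln n)\<^sup>2)) \<and>
          no_label_queries n E \<rho> (tester \<alpha> \<beta> c n E \<epsilon> \<rho>)))"
\<comment> \<open>The values \<open>42\<close> and \<open>1/16\<close> come from the maximum test
  and from the energy gap. The others can be \<open>1\<close>: the Chebyshev errors vanish with
  \<open>\<eta>\<close> without help from a constant, and the rate is itself the expected number of
  samples.\<close>
proof (rule exI[of _ 42], rule exI[of _ "1/16"], rule exI[of _ 1], rule exI[of _ 1], rule exI[of _ 1],
    rule exI[of _ 1], intro conjI)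
  have "filterlim (\<lambda>n :: nat. ln (real n)) at_top sequentially"
    by (rule filterlim_compose[OF ln_at_top filterlim_real_sequentially])
  then have "\<forall>\<^sub>F n :: nat in sequentially. 10 ^ 7 \<le> ln (real n)"
    by (simp add: filterlim_at_top)
  then show "\<forall>\<^sub>F n :: nat in sequentially. \<forall>\<epsilon>\<in>{0<..1}. \<forall>\<rho>\<in>{0<..1}.
       \<rho> \<ge> 1 * ln n powr (4/5) / (n powr (1/5) * \<epsilon> powr (4/5)) \<longrightarrow>
       (\<forall>E\<in>{path_edges n, cycle_edges n}.
          uniformity_tester n E \<epsilon> \<rho> (1/3) (tester 42 (1/16) 1 n E \<epsilon> \<rho>) \<and>
          ennreal (1 * (sqrt n / (\<epsilon>\<^sup>2 * \<rho> powr (3/2)) * (ln n)\<^sup>2))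
            \<le> sample_complexity n E \<rho> (tester 42 (1/16) 1 n E \<epsilon> \<rho>) \<and>
          sample_complexity n E \<rho> (tester 42 (1/16) 1 n E \<epsilon> \<rho>)
            \<le> ennreal (1 * (sqrt n / (\<epsilon>\<^sup>2 * \<rho> powr (3/2)) * (ln n)\<^sup>2)) \<and>
          no_label_queries n E \<rho> (tester 42 (1/16) 1 n E \<epsilon> \<rho>))"
  proof (rule eventually_mono, intro ballI impI)
    fix n :: nat and \<epsilon> \<rho> :: real and E
    assume n: "10 ^ 7 \<le> ln (real n)" and "\<epsilon> \<in> {0<..1}" "\<rho> \<in> {0<..1}"
      and *: "\<rho> \<ge> 1 * ln n powr (4/5) / (n powr (1/5) * \<epsilon> powr (4/5))"
      and E: "E \<in> {path_edges n, cycle_edges n}"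
    then have \<epsilon>\<rho>: "0 < \<epsilon>" "\<epsilon> \<le> 1" "0 < \<rho>" "\<rho> \<le> 1" by auto
    have "n > 1"
    proof (rule ccontr)
      assume "\<not> n > 1"
      then have "n = 0 \<or> n = 1" by auto
      then show False using n by auto
    qed
    have rate: "tester_rate 1 n \<epsilon> \<rho> = 1 * (sqrt n / (\<epsilon>\<^sup>2 * \<rho> powr (3/2)) * (ln n)\<^sup>2)"
      by (simp add: tester_rate_def)
    have "tester_rate 1 n \<epsilon> \<rho> > 0" using \<open>n > 1\<close> \<epsilon>\<rho> by (simp add: tester_rate_def)
    then show "uniformity_tester n E \<epsilon> \<rho> (1/3) (tester 42 (1/16) 1 n E \<epsilon> \<rho>) \<and>
          ennreal (1 * (sqrt n / (\<epsilon>\<^sup>2 * \<rho> powr (3/2)) * (ln n)\<^sup>2))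
            \<le> sample_complexity n E \<rho> (tester 42 (1/16) 1 n E \<epsilon> \<rho>) \<and>
          sample_complexity n E \<rho> (tester 42 (1/16) 1 n E \<epsilon> \<rho>)
            \<le> ennreal (1 * (sqrt n / (\<epsilon>\<^sup>2 * \<rho> powr (3/2)) * (ln n)\<^sup>2)) \<and>
          no_label_queries n E \<rho> (tester 42 (1/16) 1 n E \<epsilon> \<rho>)"
      unfolding rate[symmetric] using \<open>n > 1\<close>
      by (auto simp: sample_complexity_tester no_label_queries_tester
          intro!: uniformity_tester_tester_if_large n \<epsilon>\<rho> E resolution_bound[OF _ _ _ *])
  qed
qed simp_all

end
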